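(* Given finitely generated free groups $G$ and $H$, let $\operatorname{Epi}(G,H)$ and $\operatorname{Mono}(G,H)$ be the sets of all surjective and injective homomorphisms $G\to H$, respectively. \begin{enumerate} \item If the rank of $H$ is $1$ and the rank of $G$ is $n>1$, then \[ D(\operatorname{Epi}(G,H))=\frac1{\zeta(n)},\qquad D(\operatorname{Mono}(G,H))=0, \] where $\zeta$ is the Riemann zeta function. \item If the ranks of $G$ and $H$ are both $1$, or the rank of $H$ is greater than $1$, then \[ D(\operatorname{Epi}(G,H))=0,\qquad D(\operatorname{Mono}(G,H))=1. \] \end{enumerate}
   Context: Fix free generators $a_1,\dots,a_n$ of $G$ and a free generating set of $H$. A homomorphism $\phi:G\to H$ is identified with the $n$-tuple $(\phi(a_1),\dots,\phi(a_n))\in H^n$, so a set of homomorphisms is viewed as a subset of $H^n$. For a natural number $p$, $H_p$ is the set of elements of $H$ of reduced word length at most $p$. The asymptotic density of $S\subset H^n$ is \[ D(S)=\lim_{p\to\infty}\frac{|S\cap(H_p)^n|}{|(H_p)^n|}, \] with $|\cdot|$ cardinality; an assertion $D(S)=c$ includes existence of the limit. *)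

theory Defs
  imports Complex_Main "HOL-Algebra.Group"
begin

text \<open>
  A word is a list of letters; the letter \<open>(x, True)\<close> stands for the generator \<open>x\<close> and
  \<open>(x, False)\<close> for its formal inverse.
\<close>

definition words_over :: "'a set \<Rightarrow> ('a \<times> bool) list set" where
  "words_over X = lists (X \<times> UNIV)"

definition reduced :: "('a \<times> bool) list \<Rightarrow> bool" where
  "reduced w \<longleftrightarrow> successively (\<lambda>s t. \<not> (fst s = fst t \<and> snd s \<noteq> snd t)) w"

definition eval_letter :: "('a, 'c) monoid_scheme \<Rightarrow> 'a \<times> bool \<Rightarrow> 'a" where
  "eval_letter G s = (if snd s then fst s else inv\<^bsub>G\<^esub> (fst s))"

definition eval_word :: "('a, 'c) monoid_scheme \<Rightarrow> ('a \<times> bool) list \<Rightarrow> 'a" where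
  "eval_word G w = foldr (\<lambda>s x. eval_letter G s \<otimes>\<^bsub>G\<^esub> x) w \<one>\<^bsub>G\<^esub>"

text \<open>\<open>G\<close> is a free group and \<open>X\<close> is a set of free generators of it; the rank is \<open>card X\<close>.\<close>

definition free_group_on :: "('a, 'c) monoid_scheme \<Rightarrow> 'a set \<Rightarrow> bool" where
  "free_group_on G X \<longleftrightarrow>
     group G \<and> X \<subseteq> carrier G \<and>
     (\<forall>g \<in> carrier G. \<exists>!w. w \<in> words_over X \<and> reduced w \<and> eval_word G w = g)"

text \<open>Both notions below are meant only when \<open>free_group_on G X\<close> and \<open>g \<in> carrier G\<close>.\<close>

definition reduced_word_of :: "('a, 'c) monoid_scheme \<Rightarrow> 'a set \<Rightarrow> 'a \<Rightarrow> ('a \<times> bool) list" where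
  "reduced_word_of G X g = (THE w. w \<in> words_over X \<and> reduced w \<and> eval_word G w = g)"

definition word_length :: "('a, 'c) monoid_scheme \<Rightarrow> 'a set \<Rightarrow> 'a \<Rightarrow> nat" where
  "word_length G X g = length (reduced_word_of G X g)"

definition word_ball :: "('a, 'c) monoid_scheme \<Rightarrow> 'a set \<Rightarrow> nat \<Rightarrow> 'a set" where
  "word_ball G X p = {g \<in> carrier G. word_length G X g \<le> p}"

definition tuples :: "nat \<Rightarrow> 'a set \<Rightarrow> 'a list set" where
  "tuples n A = {xs. length xs = n \<and> set xs \<subseteq> A}"

text \<open>
  \<open>S\<close> is a set of \<open>n\<close>-tuples of elements of \<open>H\<close>, and \<open>Y\<close> the free generating set of \<open>H\<close> that
  defines word length.
\<close>

definition has_asymptotic_density ::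
    "('b, 'd) monoid_scheme \<Rightarrow> 'b set \<Rightarrow> nat \<Rightarrow> 'b list set \<Rightarrow> real \<Rightarrow> bool" where
  "has_asymptotic_density H Y n S c \<longleftrightarrow>
     (\<lambda>p. real (card (S \<inter> tuples n (word_ball H Y p))) / real (card (tuples n (word_ball H Y p))))
       \<longlonglongrightarrow> c"

text \<open>
  With \<open>gs\<close> the list of free generators of the source group, a homomorphism is identified with
  the tuple of its values on \<open>gs\<close>.
\<close>

definition hom_tuples :: "'a list \<Rightarrow> ('a \<Rightarrow> 'b) set \<Rightarrow> 'b list set" where
  "hom_tuples gs F = (\<lambda>\<phi>. map \<phi> gs) ` F"

text \<open>The Riemann zeta function on the real half-line \<open>s > 1\<close>, where its Dirichlet series converges.\<close>

definition zeta :: "real \<Rightarrow> real" where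
  "zeta s = (\<Sum>k. 1 / real (Suc k) powr s)"

end

(*
  Every tuple in H^n is the tuple of a homomorphism. If H has rank at least 2, a prefix or suffix of
  given length K occurs in a proportion of at most 2^-K of the elements of a ball. Hence, with
  K = p div 4, in almost all tuples from the ball of radius p the entries are longer than 2 K + 1 and
  no two of the entries and their inverses share a prefix of length K. In a product of such entries
  only the ends cancel, so the homomorphism is injective and its image omits the elements of length 1.

  If H is infinite cyclic, tuples are integer vectors and surjectivity means that the gcd is 1. Sorting
  the nonzero vectors of the box [-p, p]^n by gcd gives sum_(d >= 1) C(p div d) = (2 p + 1)^n - 1 for the
  number C(p) of vectors with gcd 1. With L = 2^n / zeta(n), the error e(p) = |C(p) / p^n - L| satisfies
  e(p) <= o(1) + sum_(d >= 2) d^-n e(p div d), and since zeta(n) - 1 < 1 this forces e(p) -> 0.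
*)
theory Submission
  imports Defs "HOL-Algebra.Coset" "HOL-Analysis.Uniform_Limit" "HOL-Real_Asymp.Real_Asymp"
begin

section \<open>Words and free groups\<close>

text \<open>The length K has to grow without bound while the entries of length at most 2 K + 1 stay
  negligible. As soon as 3 K + 1 <= p, these lie in the ball of radius p - K, so they obey the same
  bound as entries with a prescribed prefix; \<open>p div 4\<close> is a convenient choice. Inverses
  enter because the letters lost at the junction of two factors u and v form the common prefix of
  u^-1 and v.

  The value of L is forced: dividing the gcd count by p^n and letting p grow turns C(p) ~ L p^n into
  L zeta(n) = 2^n. The recursion takes the place of Moebius inversion, but p div d stays bounded for
  d comparable to p, where e need not be small. There only the weights d^-n help, which is why
  boundedness of e and dominated convergence are needed.\<close>

definition inv_letter :: "'a \<times> bool \<Rightarrow> 'a \<times> bool" where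
  "inv_letter s = (fst s, \<not> snd s)"

definition inv_word :: "('a \<times> bool) list \<Rightarrow> ('a \<times> bool) list" where
  "inv_word w = rev (map inv_letter w)"

lemma inv_letter_inv_letter [simp]: "inv_letter (inv_letter s) = s"
  by (simp add: inv_letter_def)

lemma fst_inv_letter [simp]: "fst (inv_letter s) = fst s"
  by (simp add: inv_letter_def)

lemma inv_letter_neq [simp]: "inv_letter s \<noteq> s"
  by (cases s) (simp add: inv_letter_def)

lemma inv_word_inv_word [simp]: "inv_word (inv_word w) = w"
  by (simp add: inv_word_def rev_map o_def)

lemma length_inv_word [simp]: "length (inv_word w) = length w"
  by (simp add: inv_word_def)

lemma inv_word_append [simp]: "inv_word (u @ v) = inv_word v @ inv_word u"
  by (simp add: inv_word_def)

lemma inv_word_Nil [simp]: "inv_word [] = []"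
  by (simp add: inv_word_def)

lemma inv_word_eq_Nil_iff [simp]: "inv_word w = [] \<longleftrightarrow> w = []"
  by (simp add: inv_word_def)

lemma last_inv_word: "w \<noteq> [] \<Longrightarrow> last (inv_word w) = inv_letter (hd w)"
  by (simp add: inv_word_def last_rev hd_map)

lemma reduced_iff: "reduced w \<longleftrightarrow> successively (\<lambda>s t. t \<noteq> inv_letter s) w"
proof -
  have "(\<lambda>s t :: 'a \<times> bool. \<not> (fst s = fst t \<and> snd s \<noteq> snd t)) = (\<lambda>s t. t \<noteq> inv_letter s)"
    by (auto simp: fun_eq_iff inv_letter_def prod_eq_iff)
  then show ?thesis
    unfolding reduced_def by (rule arg_cong[where f = "\<lambda>P. successively P w"])
qed

lemma reduced_Nil [simp]: "reduced []"
  and reduced_single [simp]: "reduced [s]"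
  by (simp_all add: reduced_def)

lemma reduced_Cons: "reduced (s # w) \<longleftrightarrow> (w = [] \<or> hd w \<noteq> inv_letter s) \<and> reduced w"
  by (auto simp: reduced_iff successively_Cons)

lemma reduced_append:
  "reduced (u @ v) \<longleftrightarrow>
     reduced u \<and> reduced v \<and> (u = [] \<or> v = [] \<or> hd v \<noteq> inv_letter (last u))"
  by (auto simp: reduced_iff successively_append_iff)

lemma reduced_inv_word [simp]: "reduced (inv_word w) \<longleftrightarrow> reduced w"
proof -
  have "(\<lambda>x y :: 'a \<times> bool. inv_letter x \<noteq> inv_letter (inv_letter y)) = (\<lambda>s t. t \<noteq> inv_letter s)"
    by (auto simp: fun_eq_iff)
  then show ?thesis
    unfolding inv_word_def reduced_iff successively_rev successively_map by (rule arg_cong[where f = "\<lambda>P. successively P w"])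
qed

lemma reduced_take: "reduced w \<Longrightarrow> reduced (take k w)"
  and reduced_drop: "reduced w \<Longrightarrow> reduced (drop k w)"
  using reduced_append[of "take k w" "drop k w"] by simp_all

lemma words_over_Nil [simp]: "[] \<in> words_over X"
  by (simp add: words_over_def)

lemma words_over_Cons [simp]: "s # w \<in> words_over X \<longleftrightarrow> fst s \<in> X \<and> w \<in> words_over X"
  by (cases s) (simp add: words_over_def)

lemma words_over_append [simp]: "u @ v \<in> words_over X \<longleftrightarrow> u \<in> words_over X \<and> v \<in> words_over X"
  by (induction u) auto

lemma words_over_inv_word [simp]: "inv_word w \<in> words_over X \<longleftrightarrow> w \<in> words_over X"
  by (induction w) (auto simp: inv_word_def)

lemma words_over_take: "w \<in> words_over X \<Longrightarrow> take k w \<in> words_over X"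
  and words_over_drop: "w \<in> words_over X \<Longrightarrow> drop k w \<in> words_over X"
  using words_over_append[of "take k w" "drop k w" X] by simp_all

lemma words_over_mono: "w \<in> words_over X \<Longrightarrow> X \<subseteq> Z \<Longrightarrow> w \<in> words_over Z"
  by (induction w) auto

lemma words_over_map: "w \<in> words_over X \<Longrightarrow> f ` X \<subseteq> Z \<Longrightarrow> map (apfst f) w \<in> words_over Z"
  by (induction w) auto

section \<open>Free reduction and evaluation of words\<close>

fun reduce_Cons :: "'a \<times> bool \<Rightarrow> ('a \<times> bool) list \<Rightarrow> ('a \<times> bool) list" where
  "reduce_Cons s [] = [s]"
| "reduce_Cons s (t # w) = (if t = inv_letter s then w else s # t # w)"

text \<open>Working from the right, each new letter meets an already reduced word and can cancel
  only with its head. One comparison per letter therefore suffices.\<close>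

definition reduce :: "('a \<times> bool) list \<Rightarrow> ('a \<times> bool) list" where
  "reduce w = foldr reduce_Cons w []"

lemma reduced_reduce_Cons: "reduced w \<Longrightarrow> reduced (reduce_Cons s w)"
  by (cases w) (auto simp: reduced_Cons)

lemma reduced_reduce: "reduced (reduce w)"
  by (induction w) (auto simp: reduce_def reduced_reduce_Cons)

lemma words_over_reduce_Cons:
  "fst s \<in> X \<Longrightarrow> w \<in> words_over X \<Longrightarrow> reduce_Cons s w \<in> words_over X"
  by (cases w) auto

lemma words_over_reduce: "w \<in> words_over X \<Longrightarrow> reduce w \<in> words_over X"
  by (induction w) (auto simp: reduce_def words_over_reduce_Cons)

context group
begin

lemma eval_letter_closed [simp]: "fst s \<in> carrier G \<Longrightarrow> eval_letter G s \<in> carrier G"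
  by (simp add: eval_letter_def)

lemma eval_letter_inv_letter:
  "fst s \<in> carrier G \<Longrightarrow> eval_letter G (inv_letter s) = inv (eval_letter G s)"
  by (simp add: eval_letter_def inv_letter_def)

lemma eval_word_Nil [simp]: "eval_word G [] = \<one>"
  by (simp add: eval_word_def)

lemma eval_word_Cons [simp]: "eval_word G (s # w) = eval_letter G s \<otimes> eval_word G w"
  by (simp add: eval_word_def)

lemma eval_word_closed [simp]: "w \<in> words_over (carrier G) \<Longrightarrow> eval_word G w \<in> carrier G"
  by (induction w) auto

lemma eval_word_append:
  "\<lbrakk>u \<in> words_over (carrier G); v \<in> words_over (carrier G)\<rbrakk>
    \<Longrightarrow> eval_word G (u @ v) = eval_word G u \<otimes> eval_word G v"
  by (induction u) (auto simp: m_assoc)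

lemma eval_word_inv_word:
  "w \<in> words_over (carrier G) \<Longrightarrow> eval_word G (inv_word w) = inv (eval_word G w)"
proof (induction w)
  case (Cons s w)
  have "inv_word (s # w) = inv_word w @ [inv_letter s]"
    by (simp add: inv_word_def)
  with Cons show ?case
    by (simp add: eval_word_append eval_letter_inv_letter inv_mult_group)
qed simp

end

lemma map_inv_letter_apfst: "inv_letter (apfst f s) = apfst f (inv_letter s)"
  by (cases s) (simp add: inv_letter_def)

text \<open>Substitution commutes with inverting a letter, so a cancelling pair is sent to a
  cancelling pair for any \<open>f\<close>. With \<open>f = id\<close> this says that reduction
  keeps the element; with a general \<open>f\<close> it makes evaluation of normal forms
  multiplicative.\<close>

lemma (in group) eval_word_map_reduce:
  assumes "w \<in> words_over X" "f ` X \<subseteq> carrier G"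
  shows "eval_word G (map (apfst f) (reduce w)) = eval_word G (map (apfst f) w)"
  using assms(1)
proof (induction w)
  case (Cons s w)
  have cl: "eval_letter G (apfst f t) \<in> carrier G" if "fst t \<in> X" for t
    using that assms(2) by auto
  have "eval_word G (map (apfst f) (reduce_Cons s v)) =
      eval_letter G (apfst f s) \<otimes> eval_word G (map (apfst f) v)"
    if v: "v \<in> words_over X" for v
  proof (cases v)
    case (Cons t v')
    have "eval_word G (map (apfst f) v') \<in> carrier G"
      using v assms(2) Cons by (auto intro!: eval_word_closed words_over_map)
    moreover have "eval_letter G (apfst f (inv_letter s)) = inv eval_letter G (apfst f s)"
      using Cons.prems assms(2)
      by (auto simp flip: map_inv_letter_apfst simp: eval_letter_inv_letter image_subset_iff)
    ultimately show ?thesis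
      using Cons Cons.prems cl[of s] by (auto simp: m_assoc[symmetric])
  qed simp
  with Cons show ?case
    using words_over_reduce[of w X] by (simp add: reduce_def)
qed (simp add: reduce_def)

lemma hom_eval_word:
  assumes "group G" "group H" and f: "f \<in> hom G H" and w: "w \<in> words_over (carrier G)"
  shows "f (eval_word G w) = eval_word H (map (apfst f) w)"
proof -
  interpret group_hom G H f
    using assms by (simp add: group_hom_def group_hom_axioms_def)
  show ?thesis
    using w by (induction w) (auto simp: eval_letter_def)
qed

section \<open>Normal forms and the universal property\<close>

locale free_group = group G for G (structure) +
  fixes X :: "'a set"
  assumes basis_closed: "X \<subseteq> carrier G"
    and ex1_reduced_word:
      "g \<in> carrier G \<Longrightarrow> \<exists>!w. w \<in> words_over X \<and> reduced w \<and> eval_word G w = g"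
begin

abbreviation nf :: "'a \<Rightarrow> ('a \<times> bool) list" where
  "nf \<equiv> reduced_word_of G X"

lemma words_over_basis: "w \<in> words_over X \<Longrightarrow> w \<in> words_over (carrier G)"
  using basis_closed by (rule words_over_mono[rotated])

lemma eval_basis_closed [simp]: "w \<in> words_over X \<Longrightarrow> eval_word G w \<in> carrier G"
  by (simp add: words_over_basis)

lemma
  assumes "g \<in> carrier G"
  shows nf_words_over [simp]: "nf g \<in> words_over X"
    and reduced_nf [simp]: "reduced (nf g)"
    and eval_nf [simp]: "eval_word G (nf g) = g"
  using theI'[OF ex1_reduced_word[OF assms]] by (auto simp: reduced_word_of_def)

lemma nf_eqI:
  assumes "w \<in> words_over X" "reduced w" "eval_word G w = g"
  shows "nf g = w"
proof -
  have "g \<in> carrier G"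
    using assms by auto
  then show ?thesis
    using ex1_reduced_word[of g] assms nf_words_over reduced_nf eval_nf by blast
qed

lemma nf_eval [simp]: "\<lbrakk>w \<in> words_over X; reduced w\<rbrakk> \<Longrightarrow> nf (eval_word G w) = w"
  by (rule nf_eqI) auto

lemma eval_word_reduce: "w \<in> words_over X \<Longrightarrow> eval_word G (reduce w) = eval_word G w"
  using eval_word_map_reduce[of w X id] basis_closed
  by (simp add: apfst_def map_prod.id)

lemma nf_eval_reduce: "w \<in> words_over X \<Longrightarrow> nf (eval_word G w) = reduce w"
  by (intro nf_eqI) (auto simp: words_over_reduce reduced_reduce eval_word_reduce)

lemma nf_one [simp]: "nf \<one> = []"
  by (rule nf_eqI) auto

lemma nf_basis: "x \<in> X \<Longrightarrow> nf x = [(x, True)]"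
  using basis_closed by (intro nf_eqI) (auto simp: eval_letter_def)

lemma nf_inv: "g \<in> carrier G \<Longrightarrow> nf (inv g) = inv_word (nf g)"
  by (intro nf_eqI) (auto simp: eval_word_inv_word words_over_basis)

lemma nf_inj: "\<lbrakk>nf g = nf h; g \<in> carrier G; h \<in> carrier G\<rbrakk> \<Longrightarrow> g = h"
  by (metis eval_nf)

text \<open>The extension substitutes \<open>f\<close> into the normal form. The normal form of a
  product is the reduction of the concatenated normal forms, and reduction does not change the value
  after substitution.\<close>

lemma ex_hom_extension:
  assumes H: "group H" and f: "f ` X \<subseteq> carrier H"
  shows "\<exists>\<phi> \<in> hom G H. \<forall>x\<in>X. \<phi> x = f x"
proof -
  interpret H: group H
    by (rule H)
  let ?\<phi> = "\<lambda>g. eval_word H (map (apfst f) (nf g))"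
  have cl: "map (apfst f) w \<in> words_over (carrier H)" if "w \<in> words_over X" for w
    using that f by (rule words_over_map)
  have "?\<phi> (g \<otimes> h) = ?\<phi> g \<otimes>\<^bsub>H\<^esub> ?\<phi> h" if "g \<in> carrier G" "h \<in> carrier G" for g h
  proof -
    have "g \<otimes> h = eval_word G (nf g @ nf h)"
      using that by (simp add: eval_word_append words_over_basis)
    then have "nf (g \<otimes> h) = reduce (nf g @ nf h)"
      using that by (simp add: nf_eval_reduce)
    then show ?thesis
      using that f by (simp add: H.eval_word_map_reduce[where X = X] H.eval_word_append cl)
  qed
  then have "?\<phi> \<in> hom G H"
    by (intro homI) (auto simp: cl)
  moreover have "?\<phi> x = f x" if "x \<in> X" for x
    using that f by (auto simp: nf_basis eval_letter_def)
  ultimately show ?thesis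
    by (intro bexI[of _ ?\<phi>]) auto
qed

lemma ex_hom_tuple:
  assumes H: "group H" and gs: "X = set gs" "distinct gs" "length gs = n"
    and xs: "xs \<in> tuples n (carrier H)"
  shows "\<exists>\<phi> \<in> hom G H. map \<phi> gs = xs"
proof -
  define f where "f = (\<lambda>x. the (map_of (zip gs xs) x))"
  have len: "length xs = length gs"
    using gs xs by (simp add: tuples_def)
  have f: "f (gs ! i) = xs ! i" if "i < n" for i
    using that gs len by (simp add: f_def map_of_zip_nth)
  have "f ` X \<subseteq> carrier H"
  proof
    fix z
    assume "z \<in> f ` X"
    then obtain i where "i < n" "z = f (gs ! i)"
      using gs by (auto simp: in_set_conv_nth)
    then have "z = xs ! i" "i < length xs"
      using f len gs by auto
    then show "z \<in> carrier H"
      using xs by (auto simp: tuples_def)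
  qed
  with H obtain \<phi> where \<phi>: "\<phi> \<in> hom G H" "\<And>x. x \<in> X \<Longrightarrow> \<phi> x = f x"
    using ex_hom_extension[of H f] by auto
  have "map \<phi> gs = xs"
  proof (rule nth_equalityI)
    fix i
    assume "i < length (map \<phi> gs)"
    then have "i < n" "gs ! i \<in> X"
      using gs by auto
    then show "map \<phi> gs ! i = xs ! i"
      using gs(3) \<phi>(2)[of "gs ! i"] f[of i] by simp
  qed (simp add: len)
  with \<phi>(1) show ?thesis
    by blast
qed

end

lemma free_group_on_iff: "free_group_on G X \<longleftrightarrow> free_group G X"
  by (auto simp: free_group_on_def free_group_def free_group_axioms_def)

section \<open>Small cancellation\<close>

text \<open>Here \<open>c\<close> is the longest common prefix. It ends before position
  \<open>k\<close>, and as both words reach that position, both have a next letter.\<close>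

lemma longest_common_prefix_shorter:
  assumes "take k a \<noteq> take k b" "k \<le> length a" "k \<le> length b"
  shows "\<exists>c d e. a = c @ d \<and> b = c @ e \<and> length c < k \<and> d \<noteq> [] \<and> e \<noteq> [] \<and> hd d \<noteq> hd e"
  using assms
proof (induction k arbitrary: a b)
  case (Suc k)
  then obtain x a' y b' where ab: "a = x # a'" "b = y # b'"
    by (metis Suc_le_length_iff)
  show ?case
  proof (cases "x = y")
    case True
    then obtain c d e where "a' = c @ d \<and> b' = c @ e \<and> length c < k \<and> d \<noteq> [] \<and> e \<noteq> [] \<and> hd d \<noteq> hd e"
      using Suc.IH[of a' b'] Suc.prems ab by auto
    then show ?thesis
      using True ab by (intro exI[of _ "x # c"] exI[of _ d] exI[of _ e]) auto
  next
    case False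
    then show ?thesis
      using ab by (intro exI[of _ "[]"] exI[of _ a] exI[of _ b]) auto
  qed
qed simp

text \<open>
  When the words \<open>W s\<close> are long and their pairwise overlaps short, the middle part of every factor
  of a product survives cancellation; the induction keeps track of the first factor only.
\<close>

lemma (in free_group) small_cancellation:
  fixes W :: "'z \<times> bool \<Rightarrow> ('a \<times> bool) list"
  assumes W: "\<And>s. fst s \<in> Z \<Longrightarrow> W s \<in> words_over X" "\<And>s. fst s \<in> Z \<Longrightarrow> reduced (W s)"
    and W_inv: "\<And>s. fst s \<in> Z \<Longrightarrow> W (inv_letter s) = inv_word (W s)"
    and long: "\<And>s. fst s \<in> Z \<Longrightarrow> 2 * k + 1 < length (W s)"
    and overlap: "\<And>s t. \<lbrakk>fst s \<in> Z; fst t \<in> Z; s \<noteq> t\<rbrakk> \<Longrightarrow> take k (W s) \<noteq> take k (W t)"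
    and v: "v \<in> words_over Z" "reduced v" "v \<noteq> []"
  shows "\<exists>r. reduced (take (length (W (hd v)) - k) (W (hd v)) @ r) \<and> r \<in> words_over X \<and>
    eval_word G (take (length (W (hd v)) - k) (W (hd v)) @ r) = eval_word G (concat (map W v))"
  using v
proof (induction v)
  case (Cons s v)
  then have s: "fst s \<in> Z"
    by simp
  show ?case
  proof (cases "v = []")
    case True
    show ?thesis
      using True W(1)[OF s] W(2)[OF s]
      by (intro exI[of _ "drop (length (W s) - k) (W s)"]) (simp add: words_over_drop)
  next
    case False
    define t where "t = hd v"
    have t: "fst t \<in> Z" "t \<noteq> inv_letter s"
      using Cons.prems False by (cases v; auto simp: t_def reduced_Cons)+
    obtain r where r: "reduced (take (length (W t) - k) (W t) @ r)" "r \<in> words_over X"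
      "eval_word G (take (length (W t) - k) (W t) @ r) = eval_word G (concat (map W v))"
      using Cons.IH Cons.prems False by (auto simp: t_def reduced_Cons)
    have s': "fst (inv_letter s) \<in> Z"
      using s by simp
    \<comment> \<open>Cancellation between \<open>W s\<close> and \<open>W t\<close> consumes the
      common prefix of the inverse of \<open>W s\<close> and of \<open>W t\<close>. As
      \<open>s # v\<close> is reduced, \<open>t\<close> is not \<open>inv_letter s\<close>, so that
      prefix is shorter than \<open>k\<close>.\<close>
    have "take k (W (inv_letter s)) \<noteq> take k (W t)"
      using overlap[of "inv_letter s" t] s t by auto
    then obtain c d e where cde: "W (inv_letter s) = c @ d" "W t = c @ e" "length c < k" "d \<noteq> []"
      "e \<noteq> []" "hd d \<noteq> hd e"
      using longest_common_prefix_shorter[of k "W (inv_letter s)" "W t"] long[OF s'] long[OF t(1)]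
      by auto
    \<comment> \<open>What remains of the protected part of \<open>W t\<close> once \<open>c\<close>
      has been cancelled; \<open>long\<close> keeps it nonempty, so the cancellation cannot reach
      \<open>r\<close>.\<close>
    define e' where "e' = take (length (W t) - k - length c) e"
    have take_t: "take (length (W t) - k) (W t) = c @ e'"
      using long[OF t(1)] cde(3) by (simp add: cde(2) e'_def)
    have e': "e' \<noteq> []" "hd e' = hd e"
      using long[OF t(1)] cde(3,5) by (auto simp: e'_def)
    have Ws: "W s = inv_word d @ inv_word c"
      using W_inv[OF s'] cde(1) by simp
    have words: "c \<in> words_over X" "d \<in> words_over X" "e' \<in> words_over X"
      using W(1)[OF s'] W(1)[OF t(1)] cde(1,2) by (auto simp: e'_def words_over_take)
    \<comment> \<open>Cancellation stops at the new junction: \<open>inv_word d\<close> ends with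
      the inverse of \<open>hd d\<close>, while \<open>e'\<close> starts with \<open>hd e\<close>,
      which differs from \<open>hd d\<close>.\<close>
    have red: "reduced (inv_word d @ e' @ r)"
      using r(1) W(2)[OF s'] cde(1,4,6) e'
      by (auto simp: take_t reduced_append last_inv_word)
    have "eval_word G (concat (map W (s # v))) = eval_word G (W s) \<otimes> eval_word G (concat (map W v))"
    proof -
      have "concat (map W v) \<in> words_over X"
        using Cons.prems(1) W(1) by (induction v) auto
      then show ?thesis
        using W(1)[OF s] by (simp add: eval_word_append words_over_basis)
    qed
    also have "\<dots> = eval_word G (inv_word d @ inv_word c) \<otimes> eval_word G (c @ e' @ r)"
      using r(3) by (simp add: Ws take_t)
    also have "\<dots> = eval_word G (inv_word d @ e' @ r)"
      using words r(2)
      by (simp add: eval_word_append eval_word_inv_word words_over_basis m_assoc)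
        (simp add: m_assoc[symmetric] words_over_basis)
    finally have ev: "eval_word G (inv_word d @ e' @ r) = eval_word G (concat (map W (s # v)))" ..
    \<comment> \<open>Fewer than \<open>k\<close> letters are lost at the end of \<open>W s\<close>,
      so its first \<open>m\<close> letters lie within \<open>inv_word d\<close> and the invariant
      is restored with a new \<open>r\<close>.\<close>
    define m where "m = length (W s) - k"
    have "m \<le> length (inv_word d)"
      using cde(3) by (simp add: m_def Ws)
    then have eq: "take m (W s) @ drop m (inv_word d) @ e' @ r = inv_word d @ e' @ r"
      by (simp add: Ws flip: append_assoc)
    have "reduced (take m (W s) @ drop m (inv_word d) @ e' @ r)"
      "eval_word G (take m (W s) @ drop m (inv_word d) @ e' @ r) = eval_word G (concat (map W (s # v)))"
      unfolding eq by (fact red ev)+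
    moreover have "drop m (inv_word d) @ e' @ r \<in> words_over X"
      using words r(2) by (simp add: words_over_drop)
    ultimately show ?thesis
      unfolding list.sel m_def by blast
  qed
qed simp

text \<open>The first factor keeps its letters except possibly the last \<open>k\<close>, hence more
  than \<open>k + 1\<close> of them and at least two even for \<open>k = 0\<close>. The bound 2
  serves both assertions: nontrivial elements avoid length 0, which gives injectivity, and nothing
  has an image of length 1, which rules out surjectivity.\<close>

lemma (in free_group) long_image:
  assumes G': "free_group G' Z" and \<phi>: "\<phi> \<in> hom G' G"
    and long: "\<And>z. z \<in> Z \<Longrightarrow> 2 * k + 1 < length (nf (\<phi> z))"
    and self: "\<And>z. z \<in> Z \<Longrightarrow> take k (nf (\<phi> z)) \<noteq> take k (nf (inv (\<phi> z)))"
    and overlap: "\<And>x z. \<lbrakk>x \<in> Z; z \<in> Z; x \<noteq> z\<rbrakk> \<Longrightarrow>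
      {take k (nf (\<phi> x)), take k (nf (inv (\<phi> x)))} \<inter> {take k (nf (\<phi> z)), take k (nf (inv (\<phi> z)))} = {}"
    and g: "g \<in> carrier G'" "g \<noteq> \<one>\<^bsub>G'\<^esub>"
  shows "2 \<le> length (nf (\<phi> g))"
proof -
  interpret G': free_group G' Z
    by (rule G')
  have \<phi>_Z: "\<phi> z \<in> carrier G" if "z \<in> Z" for z
    using that \<phi> G'.basis_closed by (auto simp: hom_def)
  define W where "W = (\<lambda>s. nf (eval_letter G (apfst \<phi> s)))"
  have letter_cl: "eval_letter G (apfst \<phi> s) \<in> carrier G" if "fst s \<in> Z" for s
    using that \<phi>_Z by simp
  have W: "W s \<in> words_over X" "reduced (W s)" "eval_word G (W s) = eval_letter G (apfst \<phi> s)"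
    if "fst s \<in> Z" for s
    using letter_cl[OF that] by (simp_all add: W_def)
  have W_inv: "W (inv_letter s) = inv_word (W s)" if "fst s \<in> Z" for s
    using that letter_cl[OF that] \<phi>_Z
    by (simp add: W_def eval_letter_inv_letter nf_inv flip: map_inv_letter_apfst)
  have W_cases: "W s = (if snd s then nf (\<phi> (fst s)) else nf (inv (\<phi> (fst s))))" for s
    by (simp add: W_def eval_letter_def)
  have W_long: "2 * k + 1 < length (W s)" if "fst s \<in> Z" for s
    using that long[OF that] \<phi>_Z[OF that] by (simp add: W_cases nf_inv)
  have W_overlap: "take k (W s) \<noteq> take k (W t)" if "fst s \<in> Z" "fst t \<in> Z" "s \<noteq> t" for s t
  \<comment> \<open>Distinct letters over the same generator are mutually inverse, which is the case
    covered by \<open>self\<close>.\<close>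
  proof (cases "fst s = fst t")
    case True
    then have "snd t = (\<not> snd s)"
      using that by (auto simp: prod_eq_iff)
    then show ?thesis
      using self[OF that(1)] True by (auto simp: W_cases)
  next
    case False
    then show ?thesis
      using overlap[OF that(1,2)] by (auto simp: W_cases)
  qed
  obtain v where v: "v \<in> words_over Z" "reduced v" "eval_word G' v = g"
    using G'.ex1_reduced_word[OF g(1)] by blast
  with g(2) have "v \<noteq> []"
    by auto
  define u where "u = take (length (W (hd v)) - k) (W (hd v))"
  obtain r where r: "reduced (u @ r)" "r \<in> words_over X"
    "eval_word G (u @ r) = eval_word G (concat (map W v))"
    unfolding u_def using small_cancellation[where W = W and k = k, OF W(1,2) W_inv W_long W_overlap v(1,2) \<open>v \<noteq> []\<close>] by blast
  have "\<phi> g = eval_word G (map (apfst \<phi>) v)"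
    using hom_eval_word[OF G'.is_group is_group \<phi> G'.words_over_basis[OF v(1)]]
    by (simp only: v(3))
  also have "\<dots> = eval_word G (concat (map W v))"
    using v(1)
  proof (induction v)
    case (Cons s v)
    from Cons.prems have "concat (map W v) \<in> words_over X"
      using W(1) by (induction v) auto
    with Cons W show ?case
      by (simp add: eval_word_append words_over_basis)
  qed simp
  finally have "\<phi> g = eval_word G (u @ r)"
    using r(3) by simp
  moreover have hd_v: "fst (hd v) \<in> Z"
    using v(1) \<open>v \<noteq> []\<close> by (cases v) auto
  moreover from this have "u \<in> words_over X"
    using W(1) by (simp add: u_def words_over_take)
  ultimately have "nf (\<phi> g) = u @ r"
    using r(1,2) by simp
  then show ?thesis
    using W_long[OF hd_v] by (simp add: u_def)
qed

section \<open>Counting overlaps in balls\<close>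

lemma finite_words_le:
  assumes "finite X"
  shows "finite {w \<in> words_over X. length w \<le> p}"
proof -
  have "{w \<in> words_over X. length w \<le> p} \<subseteq> {w. set w \<subseteq> X \<times> UNIV \<and> length w \<le> p}"
    by (auto simp: words_over_def lists_eq_set)
  moreover have "finite {w. set w \<subseteq> X \<times> (UNIV :: bool set) \<and> length w \<le> p}"
    using assms by (intro finite_lists_length_le) simp
  ultimately show ?thesis
    by (rule finite_subset)
qed

lemma finite_tuples [simp]: "finite A \<Longrightarrow> finite (tuples n A)"
  and card_tuples: "finite A \<Longrightarrow> card (tuples n A) = card A ^ n"
  using finite_lists_length_eq[of A n] card_lists_length_eq[of A n]
  by (simp_all add: tuples_def conj_commute)

lemma tuples_mono: "A \<subseteq> B \<Longrightarrow> tuples n A \<subseteq> tuples n B"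
  by (auto simp: tuples_def)

text \<open>Deleting the entry at \<open>j\<close> maps \<open>S\<close> into the tuples of length
  \<open>n - 1\<close>, and \<open>fiber\<close> bounds the number of elements of \<open>S\<close>
  sent to one of them. It serves to bound a property of tuples one coordinate at a time.\<close>

lemma card_tuples_fiber_le:
  assumes A: "finite A" and j: "j < n" and S: "S \<subseteq> tuples n A"
    and fiber: "\<And>xs. xs \<in> tuples n A \<Longrightarrow> card {y \<in> A. xs[j := y] \<in> S} \<le> m"
  shows "card S \<le> m * card A ^ (n - 1)"
proof -
  let ?fib = "\<lambda>zs. {y \<in> A. take j zs @ y # drop j zs \<in> S}"
  let ?f = "\<lambda>xs. (take j xs @ drop (Suc j) xs, xs ! j)"
  have len: "length xs = n" if "xs \<in> S" for xs
    using that S by (auto simp: tuples_def)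
  have fin: "finite (SIGMA zs : tuples (n - 1) A. ?fib zs)"
    using A by auto
  have "inj_on ?f S"
  proof (rule inj_onI)
    fix xs ys
    assume xs: "xs \<in> S" and ys: "ys \<in> S" and eq: "?f xs = ?f ys"
    then have "take j xs = take j ys" "drop (Suc j) xs = drop (Suc j) ys" "xs ! j = ys ! j"
      using j len by auto
    then show "xs = ys"
      using id_take_nth_drop[of j xs] id_take_nth_drop[of j ys] len[OF xs] len[OF ys] j by simp
  qed
  moreover have "?f ` S \<subseteq> (SIGMA zs : tuples (n - 1) A. ?fib zs)"
  proof
    fix z
    assume "z \<in> ?f ` S"
    then obtain xs where xs: "xs \<in> S" "z = ?f xs"
      by blast
    have [simp]: "length xs = n"
      using len xs by blast
    have "set (take j xs @ drop (Suc j) xs) \<subseteq> set xs"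
      using set_take_subset[of j xs] set_drop_subset[of "Suc j" xs] by auto
    moreover have "set xs \<subseteq> A"
      using xs(1) S by (auto simp: tuples_def)
    moreover from this have "xs ! j \<in> A"
      using j by (auto simp: subset_iff)
    moreover have "take j xs @ xs ! j # drop (Suc j) xs = xs"
      using id_take_nth_drop[of j xs] j by simp
    ultimately show "z \<in> (SIGMA zs : tuples (n - 1) A. ?fib zs)"
      using xs j by (auto simp: tuples_def)
  qed
  ultimately have "card S \<le> card (SIGMA zs : tuples (n - 1) A. ?fib zs)"
    using fin by (rule card_inj_on_le)
  also have "\<dots> = (\<Sum>zs\<in>tuples (n - 1) A. card (?fib zs))"
    using A by (intro card_SigmaI) auto
  also have "\<dots> \<le> (\<Sum>zs\<in>tuples (n - 1) A. m)"
  proof (rule sum_mono)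
    fix zs
    assume zs: "zs \<in> tuples (n - 1) A"
    show "card (?fib zs) \<le> m"
    \<comment> \<open>\<open>fiber\<close> speaks of complete tuples; a nonempty fibre supplies one,
      with any of its elements in the gap.\<close>
    proof (cases "?fib zs = {}")
      case False
      then obtain y where y: "y \<in> A" "take j zs @ y # drop j zs \<in> S"
        by blast
      have "length (take j zs) = j"
        using zs j by (auto simp: tuples_def)
      then have "(take j zs @ y # drop j zs)[j := y'] = take j zs @ y' # drop j zs" for y'
        by (simp add: list_update_append)
      then show ?thesis
        using fiber[of "take j zs @ y # drop j zs"] y S by auto
    qed (simp only: card.empty)
  qed
  also have "\<dots> = m * card A ^ (n - 1)"
    using A by (simp add: card_tuples)
  finally show ?thesis .
qed

section \<open>Growth of balls and words with a prescribed end\<close>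

context free_group
begin

abbreviation ball :: "nat \<Rightarrow> 'a set" where
  "ball \<equiv> word_ball G X"

lemma mem_ball: "g \<in> ball p \<longleftrightarrow> g \<in> carrier G \<and> length (nf g) \<le> p"
  by (simp add: word_ball_def word_length_def)

lemma finite_ball:
  assumes "finite X"
  shows "finite (ball p)"
proof -
  have "ball p \<subseteq> eval_word G ` {w \<in> words_over X. length w \<le> p}"
    using eval_nf by (force simp: mem_ball image_iff)
  then show ?thesis
    using finite_words_le[OF assms] finite_surj by blast
qed

lemma one_mem_ball [simp]: "\<one> \<in> ball p"
  by (simp add: mem_ball)

lemma card_ball_pos: "finite X \<Longrightarrow> 0 < card (ball p)"
  using finite_ball[of p] one_mem_ball[of p] card_gt_0_iff by blast

lemma ball_mono: "p \<le> q \<Longrightarrow> ball p \<subseteq> ball q"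
  by (auto simp: mem_ball)

lemma card_ball_mono: "finite X \<Longrightarrow> p \<le> q \<Longrightarrow> card (ball p) \<le> card (ball q)"
  by (intro card_mono finite_ball ball_mono)

lemma eval_mem_ball: "\<lbrakk>w \<in> words_over X; reduced w; length w \<le> p\<rbrakk> \<Longrightarrow> eval_word G w \<in> ball p"
  by (simp add: mem_ball)

text \<open>A reduced word can be extended on the left without cancellation by a generator other
  than that of its first letter, with either sign. Two generators always leave such a choice, and
  the two signs give the factor 2.\<close>

lemma card_ball_Suc:
  assumes X: "finite X" and y: "y1 \<in> X" "y2 \<in> X" "y1 \<noteq> y2"
  shows "2 * card (ball p) \<le> card (ball (Suc p))"
proof -
  let ?y = "\<lambda>w :: ('a \<times> bool) list. if w \<noteq> [] \<and> fst (hd w) = y1 then y2 else y1"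
  let ?f = "\<lambda>(g, b). eval_word G ((?y (nf g), b) # nf g)"
  have red: "reduced ((?y (nf g), b) # nf g)" "(?y (nf g), b) # nf g \<in> words_over X"
    if "g \<in> carrier G" for g b
    using that y by (auto simp: reduced_Cons inv_letter_def)
  have "inj_on ?f (ball p \<times> UNIV)"
  proof (rule inj_onI, clarify)
    fix g b h b'
    assume gh: "g \<in> ball p" "h \<in> ball p"
      and eq: "eval_word G ((?y (nf g), b) # nf g) = eval_word G ((?y (nf h), b') # nf h)"
    have "(?y (nf g), b) # nf g = (?y (nf h), b') # nf h"
      using nf_eval red gh eq by (metis mem_ball)
    then show "g = h \<and> b = b'"
      using gh nf_inj by (auto simp: mem_ball)
  qed
  moreover have "?f ` (ball p \<times> UNIV) \<subseteq> ball (Suc p)"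
    using red by (auto simp del: eval_word_Cons intro!: eval_mem_ball simp: mem_ball)
  ultimately have "card (ball p \<times> (UNIV :: bool set)) \<le> card (ball (Suc p))"
    using finite_ball[OF X] by (rule card_inj_on_le)
  then show ?thesis
    by (simp add: card_cartesian_product)
qed

lemma card_ball_growth:
  assumes X: "finite X" "card X > 1"
  shows "2 ^ k * card (ball p) \<le> card (ball (p + k))"
proof (induction k)
  case (Suc k)
  obtain y1 y2 where "y1 \<in> X" "y2 \<in> X" "y1 \<noteq> y2"
    using X by (metis card_le_Suc0_iff_eq One_nat_def linorder_not_less)
  from card_ball_Suc[OF X(1) this, of "p + k"] Suc.IH show ?case
    by simp
qed simp

text \<open>Removing the known prefix is injective and lands in the smaller ball. For
  \<open>k \<le> p\<close>, \<open>card_ball_growth\<close> turns this into a proportion of at most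
  2^-k.\<close>

lemma card_prefix_le:
  assumes "finite X"
  shows "card {g \<in> ball p. k \<le> length (nf g) \<and> take k (nf g) = u} \<le> card (ball (p - k))"
proof (rule card_inj_on_le)
  let ?S = "{g \<in> ball p. k \<le> length (nf g) \<and> take k (nf g) = u}"
  let ?f = "\<lambda>g. eval_word G (drop k (nf g))"
  show "inj_on ?f ?S"
  proof (rule inj_onI)
    fix g h
    assume gh: "g \<in> ?S" "h \<in> ?S" and eq: "?f g = ?f h"
    then have "nf (?f g) = nf (?f h)"
      by simp
    then have "drop k (nf g) = drop k (nf h)"
      using gh by (simp add: mem_ball words_over_drop reduced_drop)
    moreover have "take k (nf g) = take k (nf h)"
      using gh by simp
    ultimately have "nf g = nf h"
      by (metis append_take_drop_id)
    then show "g = h"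
      using gh nf_inj by (simp add: mem_ball)
  qed
  show "?f ` ?S \<subseteq> ball (p - k)"
    by (auto simp: mem_ball words_over_drop reduced_drop)
qed (use assms finite_ball in simp)

text \<open>Inversion is injective and preserves word length, which reduces a prescribed suffix to a
  prescribed prefix.\<close>

lemma card_inv_prefix_le:
  assumes "finite X"
  shows "card {g \<in> ball p. k \<le> length (nf g) \<and> take k (nf (inv g)) = u} \<le> card (ball (p - k))"
proof -
  have "card {g \<in> ball p. k \<le> length (nf g) \<and> take k (nf (inv g)) = u}
      \<le> card {g \<in> ball p. k \<le> length (nf g) \<and> take k (nf g) = u}"
  proof (rule card_inj_on_le)
    show "inj_on (m_inv G) {g \<in> ball p. k \<le> length (nf g) \<and> take k (nf (inv g)) = u}"
      by (rule inj_onI) (auto simp: mem_ball inv_equality dest: arg_cong[of _ _ "m_inv G"])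
    show "finite {g \<in> ball p. k \<le> length (nf g) \<and> take k (nf g) = u}"
      using finite_ball[OF assms, of p] by simp
  qed (auto simp: mem_ball nf_inv)
  also have "\<dots> \<le> card (ball (p - k))"
    by (rule card_prefix_le[OF assms])
  finally show ?thesis .
qed

text \<open>A word whose prefix \<open>u\<close> is inverse to its suffix is determined by what precedes that suffix.\<close>

lemma card_self_overlap_le:
  assumes "finite X"
  shows "card {g \<in> ball p. 2 * k \<le> length (nf g) \<and> take k (nf g) = take k (nf (inv g))}
    \<le> card (ball (p - k))"
proof (rule card_inj_on_le)
  let ?S = "{g \<in> ball p. 2 * k \<le> length (nf g) \<and> take k (nf g) = take k (nf (inv g))}"
  let ?t = "\<lambda>g. take (length (nf g) - k) (nf g)"
  have split: "nf g = ?t g @ inv_word (take k (?t g))" if g: "g \<in> ?S" for g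
  proof -
    have "inv_word (take k (nf (inv g))) = drop (length (nf g) - k) (nf g)"
      using g by (simp add: mem_ball nf_inv inv_word_def take_rev rev_map drop_map take_map o_def)
    moreover have "2 * k \<le> length (nf g)"
      using g by simp
    \<comment> \<open>Prefix and suffix of length \<open>k\<close> are disjoint, so the truncated
      word still contains the prefix from which the suffix is recovered.\<close>
    then have "k \<le> length (nf g) - k"
      by linarith
    then have "take k (?t g) = take k (nf g)"
      by (simp add: min_def)
    ultimately show ?thesis
      using g by auto
  qed
  show "inj_on (\<lambda>g. eval_word G (?t g)) ?S"
  proof (rule inj_onI)
    fix g h
    assume gh: "g \<in> ?S" "h \<in> ?S" and eq: "eval_word G (?t g) = eval_word G (?t h)"
    then have "nf (eval_word G (?t g)) = nf (eval_word G (?t h))"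
      by simp
    then have "?t g = ?t h"
      using gh by (simp add: mem_ball words_over_take reduced_take)
    then have "nf g = nf h"
      using split[OF gh(1)] split[OF gh(2)] by simp
    then show "g = h"
      using gh nf_inj by (simp add: mem_ball)
  qed
  show "(\<lambda>g. eval_word G (?t g)) ` ?S \<subseteq> ball (p - k)"
    by (auto simp: mem_ball words_over_take reduced_take)
qed (use assms finite_ball in simp)

section \<open>Tuples that violate the small cancellation conditions\<close>

definition ends :: "nat \<Rightarrow> 'a \<Rightarrow> ('a \<times> bool) list set" where
  "ends k g = {take k (nf g), take k (nf (inv g))}"

text \<open>The violation is attached to a single index \<open>j\<close>, so that it can be counted
  as a condition on that entry with the other entries fixed.\<close>

definition overlapping :: "nat \<Rightarrow> 'a list \<Rightarrow> nat \<Rightarrow> bool" where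
  "overlapping k xs j \<longleftrightarrow>
     length (nf (xs ! j)) \<le> 2 * k + 1 \<or>
     take k (nf (xs ! j)) = take k (nf (inv (xs ! j))) \<or>
     (\<exists>i<length xs. i \<noteq> j \<and> ends k (xs ! j) \<inter> ends k (xs ! i) \<noteq> {})"

text \<open>The constant collects one ball for short entries, one for self-overlaps, and two for
  each of the at most \<open>2 * length xs\<close> ends of entries, since such a word may begin
  \<open>nf y\<close> or \<open>nf (inv y)\<close>.\<close>

lemma card_overlapping_fiber_le:
  assumes X: "finite X" and p: "3 * k + 1 \<le> p" and j: "j < length xs"
  shows "card {y \<in> ball p. overlapping k (xs[j := y]) j}
    \<le> (4 * length xs + 2) * card (ball (p - k))"
proof -
  \<comment> \<open>The ends of the entry that gets replaced are included too; this only enlarges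
    the bound.\<close>
  define U where "U = (\<Union>i<length xs. ends k (xs ! i))"
  define A where "A = (\<lambda>u. {g \<in> ball p. k \<le> length (nf g) \<and> take k (nf g) = u})"
  define B where "B = (\<lambda>u. {g \<in> ball p. k \<le> length (nf g) \<and> take k (nf (inv g)) = u})"
  define C where "C = {g \<in> ball p. 2 * k \<le> length (nf g) \<and> take k (nf g) = take k (nf (inv g))}"
  let ?N = "card (ball (p - k))"
  have fin: "finite (A u)" "finite (B u)" "finite C" "finite U" for u
    using finite_ball[OF X, of p] by (auto simp: A_def B_def C_def U_def ends_def)
  have "card U \<le> (\<Sum>i<length xs. card (ends k (xs ! i)))"
    unfolding U_def by (rule card_UN_le) simp
  also have "\<dots> \<le> (\<Sum>i<length xs. 2)"
    by (intro sum_mono) (simp add: ends_def card_insert_if)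
  finally have card_U: "card U \<le> 2 * length xs"
    by simp
  have "{y \<in> ball p. overlapping k (xs[j := y]) j} \<subseteq> ball (2 * k + 1) \<union> C \<union> (\<Union>u\<in>U. A u \<union> B u)"
  proof
    fix y
    assume "y \<in> {y \<in> ball p. overlapping k (xs[j := y]) j}"
    then have y: "y \<in> ball p" "overlapping k (xs[j := y]) j"
      by simp_all
    show "y \<in> ball (2 * k + 1) \<union> C \<union> (\<Union>u\<in>U. A u \<union> B u)"
    proof (cases "length (nf y) \<le> 2 * k + 1 \<or> take k (nf y) = take k (nf (inv y))")
      case True
      then show ?thesis
        using y(1) by (auto simp: mem_ball C_def)
    next
      case False
      then obtain i u where "i < length xs" "i \<noteq> j" "u \<in> ends k y" "u \<in> ends k (xs ! i)"
        using y(2) j by (auto simp: overlapping_def)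
      then have "u \<in> U" "u \<in> ends k y"
        by (auto simp: U_def)
      moreover from this have "y \<in> A u \<union> B u"
        using False y(1) by (auto simp: A_def B_def ends_def)
      ultimately show ?thesis
        by blast
    qed
  qed
  moreover have "finite (ball (2 * k + 1) \<union> C \<union> (\<Union>u\<in>U. A u \<union> B u))"
    using fin finite_ball[OF X] by simp
  ultimately have "card {y \<in> ball p. overlapping k (xs[j := y]) j}
      \<le> card (ball (2 * k + 1) \<union> C \<union> (\<Union>u\<in>U. A u \<union> B u))"
    by (rule card_mono[rotated])
  also have "\<dots> \<le> card (ball (2 * k + 1)) + card C + card (\<Union>u\<in>U. A u \<union> B u)"
    by (rule order_trans[OF card_Un_le add_right_mono[OF card_Un_le]])
  also have "card (\<Union>u\<in>U. A u \<union> B u) \<le> (\<Sum>u\<in>U. card (A u \<union> B u))"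
    using fin by (intro card_UN_le) auto
  also have "\<dots> \<le> (\<Sum>u\<in>U. 2 * ?N)"
  proof (rule sum_mono)
    fix u
    have "card (A u \<union> B u) \<le> card (A u) + card (B u)"
      by (rule card_Un_le)
    then show "card (A u \<union> B u) \<le> 2 * ?N"
      using card_prefix_le[OF X, of p k u] card_inv_prefix_le[OF X, of p k u]
      by (simp add: A_def B_def)
  qed
  also have "\<dots> = card U * (2 * ?N)"
    by simp
  also have "\<dots> \<le> 2 * length xs * (2 * ?N)"
    using card_U by (rule mult_le_mono1)
  also have "card C \<le> ?N"
    unfolding C_def by (rule card_self_overlap_le[OF X])
  \<comment> \<open>This is where \<open>3 * k + 1 \<le> p\<close> is used: it says that
    \<open>2 * k + 1 \<le> p - k\<close>.\<close>
  also have "card (ball (2 * k + 1)) \<le> ?N"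
    using p by (intro card_ball_mono X) simp
  finally show ?thesis
    by (simp add: algebra_simps)
qed

lemma card_overlapping_le:
  assumes X: "finite X" and p: "3 * k + 1 \<le> p"
  shows "card {xs \<in> tuples n (ball p). \<exists>j<n. overlapping k xs j}
    \<le> n * ((4 * n + 2) * card (ball (p - k)) * card (ball p) ^ (n - 1))"
proof -
  let ?S = "\<lambda>j. {xs \<in> tuples n (ball p). overlapping k xs j}"
  have "{xs \<in> tuples n (ball p). \<exists>j<n. overlapping k xs j} = (\<Union>j<n. ?S j)"
    by auto
  then have "card {xs \<in> tuples n (ball p). \<exists>j<n. overlapping k xs j} \<le> (\<Sum>j<n. card (?S j))"
    using card_UN_le[of "{..<n}" ?S] by simp
  also have "\<dots> \<le> (\<Sum>j<n. (4 * n + 2) * card (ball (p - k)) * card (ball p) ^ (n - 1))"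
  proof (rule sum_mono)
    fix j
    assume "j \<in> {..<n}"
    then have j: "j < n"
      by simp
    show "card (?S j) \<le> (4 * n + 2) * card (ball (p - k)) * card (ball p) ^ (n - 1)"
    proof (rule card_tuples_fiber_le[OF finite_ball[OF X] j])
      fix xs
      assume "xs \<in> tuples n (ball p)"
      then have len: "length xs = n"
        by (simp add: tuples_def)
      have "card {y \<in> ball p. xs[j := y] \<in> ?S j} \<le> card {y \<in> ball p. overlapping k (xs[j := y]) j}"
        using finite_ball[OF X, of p] by (intro card_mono) auto
      also have "\<dots> \<le> (4 * n + 2) * card (ball (p - k))"
        using card_overlapping_fiber_le[OF X p, of j xs] j len by simp
      finally show "card {y \<in> ball p. xs[j := y] \<in> ?S j} \<le> (4 * n + 2) * card (ball (p - k))" .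
    qed auto
  qed
  finally show ?thesis
    by simp
qed

lemma overlapping_density:
  assumes X: "finite X" "card X > 1"
  shows "(\<lambda>p. real (card {xs \<in> tuples n (ball p). \<exists>j<n. overlapping (p div 4) xs j}) /
    real (card (tuples n (ball p)))) \<longlonglongrightarrow> 0"
proof (cases "n = 0")
  case False
  let ?f = "\<lambda>p. real (card {xs \<in> tuples n (ball p). \<exists>j<n. overlapping (p div 4) xs j}) /
    real (card (tuples n (ball p)))"
  \<comment> \<open>From \<open>p = 4\<close> on, \<open>k = p div 4\<close> is at least 1, whence
    \<open>3 * k + 1 \<le> 4 * k \<le> p\<close>.\<close>
  have "?f p \<le> real (n * (4 * n + 2)) * (1 / 2) ^ (p div 4)" if p: "p \<ge> 4" for p
  proof -
    let ?N = "real (card (ball p))" and ?k = "p div 4"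
    have N: "?N > 0"
      using card_ball_pos[OF X(1)] by simp
    have "2 ^ ?k * card (ball (p - ?k)) \<le> card (ball p)"
      using card_ball_growth[OF X, of ?k "p - ?k"] by simp
    then have "real (2 ^ ?k * card (ball (p - ?k))) \<le> ?N"
      by (rule of_nat_mono)
    then have "2 ^ ?k * real (card (ball (p - ?k))) \<le> ?N"
      by simp
    then have small: "real (card (ball (p - ?k))) \<le> (1 / 2) ^ ?k * ?N"
      by (simp add: field_simps)
    have "real (card {xs \<in> tuples n (ball p). \<exists>j<n. overlapping ?k xs j})
        \<le> real (n * ((4 * n + 2) * card (ball (p - ?k)) * card (ball p) ^ (n - 1)))"
      using p by (intro of_nat_mono card_overlapping_le X) simp
    also have "\<dots> = real (n * (4 * n + 2)) * real (card (ball (p - ?k))) * ?N ^ (n - 1)"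
      by (simp add: algebra_simps)
    also have "\<dots> \<le> real (n * (4 * n + 2)) * ((1 / 2) ^ ?k * ?N) * ?N ^ (n - 1)"
      using small by (intro mult_right_mono mult_left_mono) auto
    also have "\<dots> = real (n * (4 * n + 2)) * (1 / 2) ^ ?k * ?N ^ n"
      using False by (cases n) simp_all
    finally show ?thesis
      using N finite_ball[OF X(1), of p] by (simp add: card_tuples divide_le_eq)
  qed
  then have "\<forall>\<^sub>F p in sequentially. ?f p \<le> real (n * (4 * n + 2)) * (1 / 2) ^ (p div 4)"
    unfolding eventually_sequentially by blast
  moreover have "(\<lambda>p. real (n * (4 * n + 2)) * (1 / 2) ^ (p div 4)) \<longlonglongrightarrow> 0"
  proof -
    have "filterlim (\<lambda>p::nat. p div 4) at_top sequentially"
      unfolding filterlim_at_top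
    proof
      fix Z :: nat
      show "\<forall>\<^sub>F p in sequentially. Z \<le> p div 4"
        using eventually_ge_at_top[of "4 * Z"] by eventually_elim simp
    qed
    then have "(\<lambda>p::nat. (1 / 2 :: real) ^ (p div 4)) \<longlonglongrightarrow> 0"
      by (rule filterlim_compose[OF LIMSEQ_realpow_zero, rotated -1]) auto
    from tendsto_mult_left[OF this, of "real (n * (4 * n + 2))"] show ?thesis
      by simp
  qed
  ultimately show ?thesis
    by (rule tendsto_sandwich[OF _ _ tendsto_const, rotated]) simp
qed simp

end

section \<open>Coprime integer tuples\<close>

text \<open>
  Comparing the decreasing majorant \<open>SUP q \<ge> p. e q\<close> with itself at \<open>p div (k + 2)\<close> bounds its
  limit by a proper fraction of itself.
\<close>

lemma tendsto_zero_of_dilation_inequality: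
  fixes a e r :: "nat \<Rightarrow> real"
  assumes e: "\<And>p. 0 \<le> e p" "\<And>p. e p \<le> b"
    and a: "\<And>k. 0 \<le> a k" "summable a" "suminf a < 1"
    and r: "r \<longlonglongrightarrow> 0"
    and le: "\<And>p. 0 < p \<Longrightarrow> e p \<le> r p + (\<Sum>k. a k * e (p div (k + 2)))"
  shows "e \<longlonglongrightarrow> 0"
proof -
  \<comment> \<open>Unlike \<open>e\<close>, its majorant \<open>m\<close> is monotone and so has a
    limit from the start, the limit superior of \<open>e\<close>.\<close>
  define m where "m = (\<lambda>p. SUP q\<in>{p..}. e q)"
  have bdd: "bdd_above (e ` A)" for A
    using e(2) by (intro bdd_aboveI[of _ b]) auto
  have e_m: "e q \<le> m p" if "p \<le> q" for p q
    unfolding m_def using that by (intro cSUP_upper bdd) simp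
  have m_le: "m p \<le> c" if "\<And>q. p \<le> q \<Longrightarrow> e q \<le> c" for p c
    unfolding m_def using that by (intro cSUP_least) auto
  have m_nonneg: "0 \<le> m p" for p
    using e(1)[of p] e_m[of p p] by simp
  have m_bound: "m p \<le> b" for p
    using m_le e(2) by blast
  have "decseq m"
    by (rule decseq_SucI, rule m_le, rule e_m) simp
  then obtain l where l: "m \<longlonglongrightarrow> l" "\<And>p. l \<le> m p"
    using decseq_convergent[of m 0] m_nonneg by blast
  have l_nonneg: "0 \<le> l"
    using l(1) m_nonneg LIMSEQ_le_const by blast
  have summable_am: "summable (\<lambda>k. a k * m (p div (k + 2)))" for p
  proof (rule summable_comparison_test)
    show "\<exists>N. \<forall>k\<ge>N. norm (a k * m (p div (k + 2))) \<le> a k * b"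
      using a(1) m_nonneg m_bound by (intro exI[of _ 0]) (simp add: mult_left_mono)
  qed (intro summable_mult2 a)
  \<comment> \<open>For fixed \<open>k\<close> the argument \<open>p div (k + 2)\<close> tends to
    infinity, and \<open>a k * b\<close> dominates, so the limit may be taken termwise.\<close>
  have "(\<lambda>p. \<Sum>k. a k * m (p div (k + 2))) \<longlonglongrightarrow> (\<Sum>k. a k * l)"
  proof (rule tannerys_theorem[THEN conjunct2, THEN conjunct2])
    fix k
    have "filterlim (\<lambda>p. p div (k + 2)) at_top sequentially"
      unfolding filterlim_at_top
    proof
      fix z
      show "\<forall>\<^sub>F p in sequentially. z \<le> p div (k + 2)"
        using eventually_ge_at_top[of "z * (k + 2)"]
        by eventually_elim (simp add: less_eq_div_iff_mult_less_eq)
    qed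
    from filterlim_compose[OF l(1) this] show "(\<lambda>p. a k * m (p div (k + 2))) \<longlonglongrightarrow> a k * l"
      by (rule tendsto_mult_left)
  next
    show "\<forall>\<^sub>F (k, p) in at_top \<times>\<^sub>F sequentially. norm (a k * m (p div (k + 2))) \<le> a k * b"
      using a(1) m_nonneg m_bound by (intro always_eventually) (auto intro!: mult_left_mono)
    show "summable (\<lambda>k. a k * b)"
      using a(2) by (rule summable_mult2)
  qed simp
  moreover have "(\<Sum>k. a k * l) = suminf a * l"
    using a(2) by (rule suminf_mult2[symmetric])
  ultimately have lim: "(\<lambda>p. r p + (\<Sum>k. a k * m (p div (k + 2)))) \<longlonglongrightarrow> suminf a * l"
    using tendsto_add[OF r] by fastforce
  have "l = 0"
  proof (rule ccontr)
    assume "l \<noteq> 0"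
    with l_nonneg have "0 < l"
      by simp
    with a(3) have "suminf a * l < l"
      by simp
    \<comment> \<open>Once the right-hand side stays below \<open>c\<close> for all later indices,
      so does the supremum \<open>m p\<close>, against \<open>l \<le> m p\<close>.\<close>
    then obtain c where c: "suminf a * l < c" "c < l"
      using dense by blast
    have "\<forall>\<^sub>F p in sequentially. 0 < p \<and> r p + (\<Sum>k. a k * m (p div (k + 2))) < c"
      using order_tendstoD(2)[OF lim c(1)] eventually_gt_at_top[of 0] by eventually_elim simp
    then obtain p where p: "\<And>q. p \<le> q \<Longrightarrow> 0 < q \<and> r q + (\<Sum>k. a k * m (q div (k + 2))) < c"
      unfolding eventually_sequentially by blast
    have "m p \<le> c"
    proof (rule m_le)
      fix q
      assume q: "p \<le> q"
      have "e q \<le> r q + (\<Sum>k. a k * e (q div (k + 2)))"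
        using le p[OF q] by blast
      also have "(\<Sum>k. a k * e (q div (k + 2))) \<le> (\<Sum>k. a k * m (q div (k + 2)))"
      proof (rule suminf_le)
        show "a k * e (q div (k + 2)) \<le> a k * m (q div (k + 2))" for k
          using a(1) e_m by (simp add: mult_left_mono)
        show "summable (\<lambda>k. a k * e (q div (k + 2)))"
        proof (rule summable_comparison_test)
          show "\<exists>N. \<forall>k\<ge>N. norm (a k * e (q div (k + 2))) \<le> a k * b"
            using a(1) e by (intro exI[of _ 0]) (simp add: mult_left_mono)
        qed (intro summable_mult2 a)
      qed (rule summable_am)
      finally show "e q \<le> c"
        using p[OF q] by simp
    qed
    then show False
      using l(2)[of p] c(2) by simp
  qed
  with l(1) have "m \<longlonglongrightarrow> 0"
    by simp
  then show ?thesis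
    by (rule tendsto_sandwich[OF _ _ tendsto_const, rotated -1]) (simp_all add: e(1) e_m)
qed

section \<open>Sorting integer tuples by their gcd\<close>

definition coprime_tuples :: "nat \<Rightarrow> nat \<Rightarrow> int list set" where
  "coprime_tuples n p = {ks \<in> tuples n {- int p..int p}. Gcd (set ks) = 1}"

lemma Gcd_set_map_mult: "Gcd (set (map ((*) (int d)) ks)) = int d * Gcd (set ks)"
  by (simp add: Gcd_mult abs_mult)

text \<open>Multiplication by \<open>d\<close> is the bijection. The box scales exactly despite the
  rounding, because |d k| <= p is equivalent to |k| <= \<open>p div d\<close>.\<close>

lemma card_tuples_Gcd:
  assumes d: "0 < d"
  shows "card {ks \<in> tuples n {- int p..int p}. Gcd (set ks) = int d} = card (coprime_tuples n (p div d))"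
    (is "card ?F = _")
proof -
  have bound: "int d * k \<in> {- int p..int p} \<longleftrightarrow> k \<in> {- int (p div d)..int (p div d)}" for k
  proof -
    have "int d * k \<in> {- int p..int p} \<longleftrightarrow> \<bar>k\<bar> * int d \<le> int p"
      using abs_le_iff[of "int d * k" "int p"] by (auto simp: abs_mult mult.commute)
    also have "\<dots> \<longleftrightarrow> nat \<bar>k\<bar> * d \<le> p"
      by (simp flip: of_nat_le_iff[where 'a = int])
    also have "\<dots> \<longleftrightarrow> nat \<bar>k\<bar> \<le> p div d"
      using d by (simp add: less_eq_div_iff_mult_less_eq)
    also have "\<dots> \<longleftrightarrow> k \<in> {- int (p div d)..int (p div d)}"
      by auto
    finally show ?thesis .
  qed
  have "bij_betw (map ((*) (int d))) (coprime_tuples n (p div d)) ?F"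
  proof (rule bij_betw_imageI)
    show "inj_on (map ((*) (int d))) (coprime_tuples n (p div d))"
      using d by (intro inj_on_subset[OF inj_mapI[OF injI]]) auto
    show "map ((*) (int d)) ` coprime_tuples n (p div d) = ?F"
    proof (intro equalityI subsetI)
      fix ks
      assume "ks \<in> map ((*) (int d)) ` coprime_tuples n (p div d)"
      then obtain ls where ls: "ls \<in> coprime_tuples n (p div d)" and ks: "ks = map ((*) (int d)) ls"
        by blast
      have "set ks \<subseteq> {- int p..int p}"
      proof
        fix z
        assume "z \<in> set ks"
        then obtain l where "l \<in> set ls" "z = int d * l"
          using ks by auto
        then show "z \<in> {- int p..int p}"
          using ls bound by (auto simp only: coprime_tuples_def tuples_def mem_Collect_eq subset_iff)
      qed
      moreover have "Gcd (set ks) = int d"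
        unfolding ks Gcd_set_map_mult using ls by (simp add: coprime_tuples_def)
      moreover have "length ks = n"
        using ls by (simp add: ks coprime_tuples_def tuples_def)
      ultimately show "ks \<in> ?F"
        by (simp add: tuples_def)
    next
      fix ks
      assume ks: "ks \<in> ?F"
      define ls where "ls = map (\<lambda>k. k div int d) ks"
      have "int d dvd k" if "k \<in> set ks" for k
        using ks that Gcd_dvd[of k "set ks"] by simp
      then have ks_ls: "ks = map ((*) (int d)) ls"
        unfolding ls_def map_map by (intro map_idI[symmetric]) simp
      have "set ls \<subseteq> {- int (p div d)..int (p div d)}"
      proof
        fix l
        assume "l \<in> set ls"
        then have "int d * l \<in> set ks"
          by (subst ks_ls) auto
        then have "int d * l \<in> {- int p..int p}"
          using ks by (auto simp only: tuples_def)
        then show "l \<in> {- int (p div d)..int (p div d)}"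
          by (simp only: bound)
      qed
      moreover have "int d * Gcd (set ls) = int d"
        using ks unfolding Gcd_set_map_mult[symmetric] ks_ls[symmetric] by simp
      then have "Gcd (set ls) = 1"
        using d by simp
      ultimately have "ls \<in> coprime_tuples n (p div d)"
        using ks by (simp add: coprime_tuples_def tuples_def ls_def)
      then show "ks \<in> map ((*) (int d)) ` coprime_tuples n (p div d)"
        using ks_ls by blast
    qed
  qed
  from bij_betw_same_card[OF this] show ?thesis ..
qed

lemma card_int_box: "card (tuples n {- int p..int p}) = (2 * p + 1) ^ n"
proof -
  have "card {- int p..int p} = 2 * p + 1"
    by auto
  then show ?thesis
    by (simp add: card_tuples)
qed

text \<open>The gcd of a nonzero tuple divides a nonzero entry and hence lies between 1 and
  \<open>p\<close>. The added 1 is the zero tuple, the only one with gcd 0.\<close>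

lemma sum_card_coprime_tuples:
  assumes n: "0 < n"
  shows "(\<Sum>k<p. card (coprime_tuples n (p div Suc k))) + 1 = (2 * p + 1) ^ n"
proof -
  define F where "F = (\<lambda>d. {ks \<in> tuples n {- int p..int p}. Gcd (set ks) = int d})"
  have fin: "finite (F d)" for d
    by (simp add: F_def)
  have "F 0 = {replicate n 0}"
  proof -
    have "ks \<in> F 0 \<longleftrightarrow> ks = replicate n 0" for ks
      by (auto simp: F_def tuples_def subset_iff replicate_eqI intro!: replicate_eqI)
    then show ?thesis
      by blast
  qed
  moreover have "(\<Union>d\<le>p. F d) = tuples n {- int p..int p}"
  proof (intro equalityI subsetI)
    fix ks
    assume ks: "ks \<in> tuples n {- int p..int p}"
    have "nat (Gcd (set ks)) \<le> p"
    proof (cases "set ks \<subseteq> {0}")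
      case True
      then have "Gcd (set ks) = 0"
        by simp
      then show ?thesis
        by (simp only: nat_zero_as_int of_nat_0 nat_int zero_le)
    next
      case False
      then obtain k where k: "k \<in> set ks" "k \<noteq> 0"
        by blast
      then have "\<bar>Gcd (set ks)\<bar> \<le> \<bar>k\<bar>"
        using dvd_imp_le_int Gcd_dvd by blast
      moreover have "k \<in> {- int p..int p}"
        using k ks by (auto simp only: tuples_def)
      ultimately show ?thesis
        by auto
    qed
    moreover have "ks \<in> F (nat (Gcd (set ks)))"
      using ks by (simp add: F_def)
    ultimately show "ks \<in> (\<Union>d\<le>p. F d)"
      by blast
  qed (auto simp: F_def)
  moreover have "card (\<Union>d\<le>p. F d) = (\<Sum>d\<le>p. card (F d))"
    using fin by (intro card_UN_disjoint) (auto simp: F_def)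
  moreover have "(\<Sum>d\<le>p. card (F d)) = card (F 0) + (\<Sum>k<p. card (F (Suc k)))"
    using sum.lessThan_Suc_shift[of "\<lambda>d. card (F d)" p] by (simp add: lessThan_Suc_atMost)
  moreover have "card (F (Suc k)) = card (coprime_tuples n (p div Suc k))" for k
    unfolding F_def by (rule card_tuples_Gcd) simp
  ultimately show ?thesis
    by (simp add: card_int_box)
qed

text \<open>This settles the degenerate boxes: divisors larger than \<open>p\<close>, and
  \<open>p = 0\<close>, where a quotient by p takes the default value 0.\<close>

lemma card_coprime_tuples_0 [simp]: "card (coprime_tuples n 0) = 0"
proof -
  have False if "ks \<in> coprime_tuples n 0" for ks
  proof -
    have zero: "set ks \<subseteq> {0}" and Gcd: "Gcd (set ks) = 1"
      using that by (simp_all add: coprime_tuples_def tuples_def)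
    from zero have "Gcd (set ks) = 0"
      by (simp only: Gcd_0_iff)
    with Gcd show False
      by (metis zero_neq_one)
  qed
  then have "coprime_tuples n 0 = {}"
    by blast
  then show ?thesis
    by simp
qed

text \<open>The shift 3/2 comes from (k + 3/2)(k + 5/2) = (k + 2)^2 - 1/4. The resulting telescoping
  series has sum 2/3, whereas comparison with 1 / ((k + 1)(k + 2)) would give the bound 1 and no
  room for a strict inequality.\<close>

lemma sums_inverse_power_le:
  assumes n: "2 \<le> n"
  shows "summable (\<lambda>k. 1 / real (Suc k) ^ n)" "(\<Sum>k. 1 / real (k + 2) ^ n) < 1"
proof -
  have le: "1 / real (k + 2) ^ n \<le> 1 / (real k + 3 / 2) - 1 / (real (Suc k) + 3 / 2)" for k
  proof -
    have "(real k + 3 / 2) * (real (Suc k) + 3 / 2) \<le> real (k + 2) ^ 2"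
      by (simp add: power2_eq_square algebra_simps)
    also have "\<dots> \<le> real (k + 2) ^ n"
      using n by (intro power_increasing) simp_all
    finally have "1 / real (k + 2) ^ n \<le> 1 / ((real k + 3 / 2) * (real (Suc k) + 3 / 2))"
      by (intro divide_left_mono) simp_all
    also have "\<dots> = 1 / (real k + 3 / 2) - 1 / (real (Suc k) + 3 / 2)"
      by (simp add: field_simps)
    finally show ?thesis .
  qed
  have "(\<lambda>k. 1 / (real k + 3 / 2)) \<longlonglongrightarrow> 0"
    by real_asymp
  from telescope_sums'[OF this]
  have tel: "(\<lambda>k. 1 / (real k + 3 / 2) - 1 / (real (Suc k) + 3 / 2)) sums (2 / 3)"
    by simp
  have shift: "summable (\<lambda>k. 1 / real (k + 2) ^ n)"
  proof (rule summable_comparison_test)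
    show "\<exists>N. \<forall>k\<ge>N. norm (1 / real (k + 2) ^ n) \<le> 1 / (real k + 3 / 2) - 1 / (real (Suc k) + 3 / 2)"
      using le by (intro exI[of _ 0]) simp
  qed (use tel in \<open>rule sums_summable\<close>)
  then show "summable (\<lambda>k. 1 / real (Suc k) ^ n)"
    using summable_iff_shift[of "\<lambda>k. 1 / real (Suc k) ^ n" 1] by (simp add: algebra_simps)
  have "(\<Sum>k. 1 / real (k + 2) ^ n) \<le> (\<Sum>k. 1 / (real k + 3 / 2) - 1 / (real (Suc k) + 3 / 2))"
    using le shift sums_summable[OF tel] by (rule suminf_le)
  also have "\<dots> = 2 / 3"
    using tel by (rule sums_unique[symmetric])
  finally show "(\<Sum>k. 1 / real (k + 2) ^ n) < 1"
    by simp
qed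

section \<open>The density of coprime integer tuples\<close>

lemma zeta_of_nat: "zeta (real n) = (\<Sum>k. 1 / real (Suc k) ^ n)"
  by (simp add: zeta_def powr_realpow)

text \<open>After division by p^n the gcd count says that the series with terms
  \<open>w p k * g (p div Suc k)\<close> has sum \<open>N p\<close>. Subtracting \<open>L\<close>
  times the sum of the weights turns this into a relation for the error \<open>g - L\<close>, to
  which \<open>tendsto_zero_of_dilation_inequality\<close> applies.\<close>

lemma coprime_tuples_density:
  assumes n: "2 \<le> n"
  shows "(\<lambda>p. real (card (coprime_tuples n p)) / real ((2 * p + 1) ^ n)) \<longlonglongrightarrow> 1 / zeta (real n)"
proof -
  let ?C = "\<lambda>p. real (card (coprime_tuples n p))"
  define z where "z = zeta (real n)"
  define g where "g = (\<lambda>p. ?C p / real p ^ n)"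
  define L where "L = 2 ^ n / z"
  define a where "a = (\<lambda>k. 1 / real (Suc k) ^ n)"
  \<comment> \<open>Because of rounding the weights are not d^-n but only approach it from below;
    the discrepancy goes into the vanishing term.\<close>
  define w where "w = (\<lambda>p k. (real (p div Suc k) / real p) ^ n)"
  define N where "N = (\<lambda>p. ((2 * real p + 1) ^ n - 1) / real p ^ n)"
  have summable_a: "summable a"
    unfolding a_def by (rule sums_inverse_power_le(1)[OF n])
  have z: "z = suminf a"
    by (simp add: z_def zeta_of_nat a_def)
  have "0 < z"
    unfolding z using summable_a by (intro suminf_pos) (auto simp: a_def)
  have w_nonneg: "0 \<le> w p k" for p k
    by (simp add: w_def)
  have w_le: "w p k \<le> a k" for p k
  proof -
    have "real (p div Suc k) / real p \<le> 1 / real (Suc k)"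
      using of_nat_div_le_of_nat[of p "Suc k", where 'a = real]
      by (cases "p = 0") (simp_all add: field_simps)
    then have "w p k \<le> (1 / real (Suc k)) ^ n"
      unfolding w_def by (intro power_mono) simp_all
    then show ?thesis
      by (simp add: a_def power_divide)
  qed
  have summable_w: "summable (w p)" for p
    by (rule summable_comparison_test[OF _ summable_a])
      (use w_le w_nonneg in \<open>auto intro!: exI[of _ 0]\<close>)
  have w_lim: "(\<lambda>p. w p k) \<longlonglongrightarrow> a k" for k
  proof -
    have "(\<lambda>p. real (p div Suc k) / real p) \<longlonglongrightarrow> 1 / real (Suc k)"
    proof (rule tendsto_sandwich)
      show "\<forall>\<^sub>F p in sequentially. 1 / real (Suc k) - 1 / real p \<le> real (p div Suc k) / real p"
        using eventually_gt_at_top[of 0]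
      proof eventually_elim
        case (elim p)
        have "p < Suc k + p div Suc k * Suc k"
          by (rule dividend_less_div_times) simp
        then have "real p < real (Suc k) + real (p div Suc k) * real (Suc k)"
          by (metis of_nat_add of_nat_less_iff of_nat_mult)
        then have "real p / real (Suc k) - 1 \<le> real (p div Suc k)"
          by (simp add: field_simps del: of_nat_Suc)
        then have "(real p / real (Suc k) - 1) / real p \<le> real (p div Suc k) / real p"
          by (rule divide_right_mono) simp
        with elim show ?case
          by (simp add: diff_divide_distrib del: of_nat_Suc)
      qed
      show "\<forall>\<^sub>F p in sequentially. real (p div Suc k) / real p \<le> 1 / real (Suc k)"
        using eventually_gt_at_top[of 0]
      proof eventually_elim
        case (elim p)
        then show ?case
          using of_nat_div_le_of_nat[of p "Suc k", where 'a = real] by (simp add: field_simps)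
      qed
      show "(\<lambda>p. 1 / real (Suc k) - 1 / real p) \<longlonglongrightarrow> 1 / real (Suc k)"
        by real_asymp
    qed simp
    then have "(\<lambda>p. w p k) \<longlonglongrightarrow> (1 / real (Suc k)) ^ n"
      unfolding w_def by (rule tendsto_power)
    then show ?thesis
      by (simp add: a_def power_divide)
  qed
  have W_lim: "(\<lambda>p. suminf (w p)) \<longlonglongrightarrow> z"
    unfolding z
  proof (rule tannerys_theorem[THEN conjunct2, THEN conjunct2, OF w_lim _ summable_a])
    show "\<forall>\<^sub>F (k, p) in at_top \<times>\<^sub>F sequentially. norm (w p k) \<le> a k"
      using w_le w_nonneg by (intro always_eventually) auto
  qed simp
  have N_lim: "N \<longlonglongrightarrow> 2 ^ n"
  proof -
    have "(\<lambda>p. (2 + 1 / real p) ^ n - (1 / real p) ^ n) \<longlonglongrightarrow> (2 + 0) ^ n - 0 ^ n"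
      by (intro tendsto_intros lim_1_over_n)
    moreover have "\<forall>\<^sub>F p in sequentially. (2 + 1 / real p) ^ n - (1 / real p) ^ n = N p"
      using eventually_gt_at_top[of 0]
    proof eventually_elim
      case (elim p)
      then have "2 + 1 / real p = (2 * real p + 1) / real p"
        by (simp add: field_simps)
      then show ?case
        by (simp add: N_def power_divide diff_divide_distrib)
    qed
    ultimately show ?thesis
      using n by (auto simp: zero_power elim: Lim_transform_eventually)
  qed
  have C_w: "?C (p div Suc k) / real p ^ n = w p k * g (p div Suc k)" for p k
    using n by (cases "p div Suc k = 0") (simp_all add: w_def g_def power_divide)
  have g_sums: "(\<lambda>k. w p k * g (p div Suc k)) sums N p" for p
  proof -
    have "(\<lambda>k. w p k * g (p div Suc k)) sums (\<Sum>k<p. w p k * g (p div Suc k))"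
      using n by (intro sums_finite) (auto simp: w_def)
    also have "(\<Sum>k<p. w p k * g (p div Suc k)) = real (\<Sum>k<p. card (coprime_tuples n (p div Suc k))) / real p ^ n"
      by (simp add: sum_divide_distrib flip: C_w)
    also have "(\<Sum>k<p. card (coprime_tuples n (p div Suc k))) = (2 * p + 1) ^ n - 1"
      using sum_card_coprime_tuples[of n p] n by simp
    finally show ?thesis
      by (simp add: N_def add.commute)
  qed
  have g_bound: "0 \<le> g p" "g p \<le> 3 ^ n" for p
  proof -
    show "0 \<le> g p"
      by (simp add: g_def)
    show "g p \<le> 3 ^ n"
    proof (cases "p = 0")
      case False
      have "card (coprime_tuples n p) \<le> (2 * p + 1) ^ n"
        unfolding card_int_box[symmetric] coprime_tuples_def by (intro card_mono) auto
      also have "\<dots> \<le> (3 * p) ^ n"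
        using False by (intro power_mono) auto
      finally have "?C p \<le> real ((3 * p) ^ n)"
        by (rule of_nat_mono)
      then show ?thesis
        using False by (simp add: g_def divide_le_eq power_mult_distrib)
    qed (use n in \<open>simp add: g_def\<close>)
  qed
  define e where "e = (\<lambda>p. \<bar>g p - L\<bar>)"
  have e_bound: "e p \<le> 3 ^ n + \<bar>L\<bar>" for p
    using g_bound[of p] by (simp add: e_def)
  have a_Suc: "summable (\<lambda>k. a (Suc k))"
    using summable_a by (simp add: summable_Suc_iff)
  have "e \<longlonglongrightarrow> 0"
  proof (rule tendsto_zero_of_dilation_inequality)
    show "0 \<le> e p" "e p \<le> 3 ^ n + \<bar>L\<bar>" for p
      using e_bound by (simp_all add: e_def)
    show "0 \<le> a (Suc k)" for k
      by (simp add: a_def)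
    show "(\<Sum>k. a (Suc k)) < 1"
      using sums_inverse_power_le(2)[OF n] by (simp add: a_def add.commute)
    \<comment> \<open>\<open>L\<close> was chosen to make this limit 0.\<close>
    have "(\<lambda>p. \<bar>N p - L * suminf (w p)\<bar>) \<longlonglongrightarrow> \<bar>2 ^ n - L * z\<bar>"
      by (intro tendsto_intros N_lim W_lim)
    then show "(\<lambda>p. \<bar>N p - L * suminf (w p)\<bar>) \<longlonglongrightarrow> 0"
      using \<open>0 < z\<close> by (simp add: L_def)
  next
    fix p :: nat
    assume p: "0 < p"
    let ?h = "\<lambda>k. w p k * (g (p div Suc k) - L)"
    have sums: "?h sums (N p - L * suminf (w p))"
      using sums_diff[OF g_sums[of p] sums_mult[OF summable_sums[OF summable_w], of L]]
      by (simp add: algebra_simps)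
    have sum_ae: "summable (\<lambda>k. a (Suc k) * e (p div (k + 2)))"
    proof (rule summable_comparison_test)
      show "\<exists>M. \<forall>k\<ge>M. norm (a (Suc k) * e (p div (k + 2))) \<le> a (Suc k) * (3 ^ n + \<bar>L\<bar>)"
        using e_bound by (intro exI[of _ 0]) (simp add: a_def e_def divide_right_mono)
    qed (intro summable_mult2 a_Suc)
    have h_le: "norm (?h (Suc k)) \<le> a (Suc k) * e (p div (k + 2))" for k
      using w_le[of p "Suc k"] w_nonneg[of p "Suc k"]
      by (simp add: e_def abs_mult mult_right_mono)
    \<comment> \<open>The term for divisor 1 has weight 1 and argument \<open>p\<close>; isolating
      it leaves the divisors d >= 2, whose total weight is less than 1.\<close>
    have "suminf ?h = ?h 0 + (\<Sum>k. ?h (Suc k))"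
      using suminf_split_head[OF sums_summable[OF sums]] by simp
    moreover have "?h 0 = g p - L"
      using p by (simp add: w_def)
    ultimately have "g p - L = (N p - L * suminf (w p)) - (\<Sum>k. ?h (Suc k))"
      using sums_unique[OF sums] by simp
    then have "e p \<le> \<bar>N p - L * suminf (w p)\<bar> + norm (\<Sum>k. ?h (Suc k))"
      unfolding e_def by simp
    also have "norm (\<Sum>k. ?h (Suc k)) \<le> (\<Sum>k. a (Suc k) * e (p div (k + 2)))"
      using h_le sum_ae by (rule norm_suminf_le)
    finally show "e p \<le> \<bar>N p - L * suminf (w p)\<bar> + (\<Sum>k. a (Suc k) * e (p div (k + 2)))"
      by simp
  qed (fact a_Suc)
  then have g_lim: "g \<longlonglongrightarrow> L"
    unfolding e_def by (simp add: tendsto_rabs_zero_iff LIM_zero_iff)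
  \<comment> \<open>Change of normalisation from p^n to the size (2 p + 1)^n of the box.\<close>
  have "(\<lambda>p. real p / (2 * real p + 1)) \<longlonglongrightarrow> 1 / 2"
    by real_asymp
  from tendsto_mult[OF g_lim tendsto_power[OF this, of n]]
  have "(\<lambda>p. g p * (real p / (2 * real p + 1)) ^ n) \<longlonglongrightarrow> L * (1 / 2) ^ n" .
  moreover have "L * (1 / 2) ^ n = 1 / z"
    by (simp add: L_def power_divide)
  moreover have "g p * (real p / (2 * real p + 1)) ^ n = ?C p / real ((2 * p + 1) ^ n)" for p
    using n by (cases "p = 0") (simp_all add: g_def power_divide add.commute)
  ultimately show ?thesis
    by (simp add: z_def)
qed

section \<open>Densities of homomorphisms\<close>

context free_group
begin

lemma tuples_ball_subset: "tuples n (ball p) \<subseteq> tuples n (carrier G)"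
  by (intro tuples_mono) (auto simp: mem_ball)

lemma card_tuples_ball_pos: "finite X \<Longrightarrow> 0 < card (tuples n (ball p))"
  by (simp add: card_tuples finite_ball card_ball_pos)

lemma density_zeroI:
  assumes X: "finite X" and B: "\<And>p. S \<inter> tuples n (ball p) \<subseteq> B p" "\<And>p. finite (B p)"
    and lim: "(\<lambda>p. real (card (B p)) / real (card (tuples n (ball p)))) \<longlonglongrightarrow> 0"
  shows "has_asymptotic_density G X n S 0"
  unfolding has_asymptotic_density_def
proof (rule tendsto_sandwich[OF _ _ tendsto_const lim])
  have "card (S \<inter> tuples n (ball p)) \<le> card (B p)" for p
    using B by (intro card_mono)
  then show "\<forall>\<^sub>F p in sequentially. real (card (S \<inter> tuples n (ball p))) / real (card (tuples n (ball p)))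
      \<le> real (card (B p)) / real (card (tuples n (ball p)))"
    by (intro always_eventually allI divide_right_mono) simp_all
qed simp

lemma density_one_of_complement:
  assumes X: "finite X" and zero: "has_asymptotic_density G X n (tuples n (carrier G) - S) 0"
  shows "has_asymptotic_density G X n S 1"
proof -
  let ?T = "\<lambda>p. tuples n (ball p)"
  have "real (card (S \<inter> ?T p)) / real (card (?T p)) =
      1 - real (card ((tuples n (carrier G) - S) \<inter> ?T p)) / real (card (?T p))" for p
  proof -
    have fin: "finite (?T p)"
      by (simp add: finite_ball X)
    have "(tuples n (carrier G) - S) \<inter> ?T p = ?T p - S \<inter> ?T p"
      using tuples_ball_subset[of n p] by blast
    moreover have "card (?T p - S \<inter> ?T p) = card (?T p) - card (S \<inter> ?T p)"
      using fin by (intro card_Diff_subset) auto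
    moreover have "card (S \<inter> ?T p) \<le> card (?T p)"
      using fin by (intro card_mono) auto
    ultimately show ?thesis
      using card_tuples_ball_pos[OF X, of n p] by (simp add: diff_divide_distrib of_nat_diff)
  qed
  moreover have "(\<lambda>p. 1 - real (card ((tuples n (carrier G) - S) \<inter> ?T p)) / real (card (?T p)))
      \<longlonglongrightarrow> 1 - 0"
    using zero unfolding has_asymptotic_density_def by (intro tendsto_intros)
  ultimately show ?thesis
    by (simp add: has_asymptotic_density_def)
qed

lemma long_image_of_not_overlapping:
  assumes G': "free_group G' (set gs)" and \<phi>: "\<phi> \<in> hom G' G"
    and no: "\<not> (\<exists>j<length gs. overlapping k (map \<phi> gs) j)"
    and g: "g \<in> carrier G'" "g \<noteq> \<one>\<^bsub>G'\<^esub>"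
  shows "2 \<le> length (nf (\<phi> g))"
proof (rule long_image[OF G' \<phi> _ _ _ g])
  fix z
  assume "z \<in> set gs"
  then obtain j where "j < length gs" "z = gs ! j"
    by (auto simp: in_set_conv_nth)
  with no show "2 * k + 1 < length (nf (\<phi> z))" "take k (nf (\<phi> z)) \<noteq> take k (nf (inv (\<phi> z)))"
    by (auto simp: overlapping_def)
next
  fix x z
  assume xz: "x \<in> set gs" "z \<in> set gs" "x \<noteq> z"
  then obtain i j where ij: "i < length gs" "j < length gs" "x = gs ! i" "z = gs ! j"
    by (auto simp: in_set_conv_nth)
  with xz have "j \<noteq> i"
    by auto
  with no ij show "{take k (nf (\<phi> x)), take k (nf (inv (\<phi> x)))} \<inter>
      {take k (nf (\<phi> z)), take k (nf (inv (\<phi> z)))} = {}"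
    by (auto simp: overlapping_def ends_def)
qed

lemma higher_rank_density:
  assumes G': "free_group G' (set gs)" and gs: "distinct gs" "length gs = n"
    and X: "finite X" "card X > 1"
  shows "has_asymptotic_density G X n (hom_tuples gs (epi G' G)) 0"
    and "has_asymptotic_density G X n (hom_tuples gs (mon G' G)) 1"
proof -
  interpret G': free_group G' "set gs"
    by (rule G')
  define B where "B = (\<lambda>p. {xs \<in> tuples n (ball p). \<exists>j<n. overlapping (p div 4) xs j})"
  have B: "finite (B p)" for p
    by (simp add: B_def finite_ball X)
  have lim: "(\<lambda>p. real (card (B p)) / real (card (tuples n (ball p)))) \<longlonglongrightarrow> 0"
    unfolding B_def by (rule overlapping_density[OF X])
  have long: "2 \<le> length (nf (\<phi> g))"
    if "\<phi> \<in> hom G' G" "map \<phi> gs \<in> tuples n (ball p)" "map \<phi> gs \<notin> B p"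
      "g \<in> carrier G'" "g \<noteq> \<one>\<^bsub>G'\<^esub>" for \<phi> p g
    using that gs by (intro long_image_of_not_overlapping[OF G', where k = "p div 4"]) (auto simp: B_def)
  have one: "\<phi> \<one>\<^bsub>G'\<^esub> = \<one>" if "\<phi> \<in> hom G' G" for \<phi>
    using that hom_one G'.is_group is_group by blast
  show "has_asymptotic_density G X n (hom_tuples gs (epi G' G)) 0"
  proof (rule density_zeroI[OF X(1) _ B lim], rule subsetI, rule ccontr)
    fix p xs
    assume xs: "xs \<in> hom_tuples gs (epi G' G) \<inter> tuples n (ball p)" and "xs \<notin> B p"
    then obtain \<phi> where \<phi>: "\<phi> \<in> hom G' G" "\<phi> ` carrier G' = carrier G" "xs = map \<phi> gs"
      by (auto simp: hom_tuples_def epi_def)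
    \<comment> \<open>A basis element has length 1, which no image can have: the identity gives
      length 0 and every other element at least 2.\<close>
    from X have "X \<noteq> {}"
      by auto
    then obtain y where y: "y \<in> X"
      by blast
    then have "y \<in> \<phi> ` carrier G'"
      using \<phi>(2) basis_closed by auto
    then obtain g where g: "g \<in> carrier G'" "\<phi> g = y"
      by blast
    have "length (nf (\<phi> g)) = 1"
      using g y by (simp add: nf_basis)
    moreover have "2 \<le> length (nf (\<phi> g))" if "g \<noteq> \<one>\<^bsub>G'\<^esub>"
      using long[OF \<phi>(1) _ _ g(1) that, of p] xs \<open>xs \<notin> B p\<close> \<phi>(3) by simp
    moreover have "length (nf (\<phi> g)) = 0" if "g = \<one>\<^bsub>G'\<^esub>"
      using one[OF \<phi>(1)] that by simp
    ultimately show False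
      by fastforce
  qed
  show "has_asymptotic_density G X n (hom_tuples gs (mon G' G)) 1"
  proof (rule density_one_of_complement[OF X(1)],
      rule density_zeroI[OF X(1) _ B lim], rule subsetI, rule ccontr)
    fix p xs
    assume xs: "xs \<in> (tuples n (carrier G) - hom_tuples gs (mon G' G)) \<inter> tuples n (ball p)"
      and "xs \<notin> B p"
    \<comment> \<open>Every tuple comes from some homomorphism by the universal property, so outside
      \<open>B p\<close> the tuple is that of an injective one, a contradiction.\<close>
    then obtain \<phi> where \<phi>: "\<phi> \<in> hom G' G" "map \<phi> gs = xs"
      using G'.ex_hom_tuple[OF is_group refl gs, of xs] by auto
    interpret hom: group_hom G' G \<phi>
      using \<phi>(1) by unfold_locales
    have "g = \<one>\<^bsub>G'\<^esub>" if "g \<in> carrier G'" "\<phi> g = \<one>" for g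
      using long[OF \<phi>(1) _ _ that(1), of p] xs \<open>xs \<notin> B p\<close> \<phi>(2) that(2) by fastforce
    then have "\<phi> \<in> mon G' G"
      using \<phi>(1) by (simp add: mon_def hom.inj_on_one_iff)
    with \<phi>(2) xs show False
      by (auto simp: hom_tuples_def)
  qed
qed

end

section \<open>Infinite cyclic target groups\<close>

locale rank_one_free_group = free_group G "{y}" for G (structure) and y
begin

abbreviation gpow :: "int \<Rightarrow> 'a" where
  "gpow k \<equiv> y [^] k"

lemma y_closed [simp]: "y \<in> carrier G"
  using basis_closed by simp

lemma pow_surj:
  assumes "g \<in> carrier G"
  shows "\<exists>k. g = gpow k"
proof -
  have "\<exists>k. eval_word G w = gpow k" if "w \<in> words_over {y}" for w
    using that
  proof (induction w)
    case Nil
    show ?case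
      by (intro exI[of _ 0]) simp
  next
    case (Cons s w)
    then obtain k where "eval_word G w = gpow k" "fst s = y"
      by auto
    moreover have "eval_letter G s = gpow (if snd s then 1 else - 1)" if "fst s = y"
      using that by (simp add: eval_letter_def int_pow_neg)
    ultimately have "eval_word G (s # w) = gpow ((if snd s then 1 else - 1) + k)"
      by (simp add: int_pow_mult)
    then show ?case
      by blast
  qed
  from this[of "nf g"] assms show ?thesis
    by simp
qed

text \<open>Word length becomes the absolute value of the exponent, so balls are integer intervals.
  For \<open>k = 0\<close> the word is empty and its sign flag invisible.\<close>

lemma nf_pow: "nf (gpow k) = replicate (nat \<bar>k\<bar>) (y, 0 \<le> k)"
proof (rule nf_eqI)
  show "replicate (nat \<bar>k\<bar>) (y, 0 \<le> k) \<in> words_over {y}"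
    by (auto simp: words_over_def)
  show "reduced (replicate (nat \<bar>k\<bar>) (y, 0 \<le> k))"
  proof (induction "nat \<bar>k\<bar>")
    case (Suc m)
    have "reduced (replicate m s)" for m and s :: "'a \<times> bool"
      by (induction m) (auto simp: reduced_Cons hd_replicate inv_letter_neq[symmetric])
    then show ?case .
  qed simp
  have "eval_word G (replicate m (y, True)) = gpow (int m)" for m
    by (induction m) (simp_all add: eval_letter_def int_pow_mult)
  moreover have "eval_word G (replicate m (y, False)) = gpow (- int m)" for m
  proof (induction m)
    case (Suc m)
    have "eval_word G (replicate (Suc m) (y, False)) = gpow (- 1) \<otimes> gpow (- int m)"
      using Suc by (simp add: eval_letter_def int_pow_neg)
    also have "\<dots> = gpow (- int (Suc m))"
      by (simp flip: int_pow_mult)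
    finally show ?case .
  qed simp
  ultimately show "eval_word G (replicate (nat \<bar>k\<bar>) (y, 0 \<le> k)) = gpow k"
    by (cases "0 \<le> k") simp_all
qed

lemma inj_pow: "inj gpow"
proof (rule injI)
  fix k l
  assume "gpow k = gpow l"
  then have "replicate (nat \<bar>k\<bar>) (y, 0 \<le> k) = replicate (nat \<bar>l\<bar>) (y, 0 \<le> l)"
    by (metis nf_pow)
  then show "k = l"
    by (auto simp: replicate_eq_replicate split: if_splits)
qed

lemma tuples_ball_eq: "tuples n (ball p) = map gpow ` tuples n {- int p..int p}"
proof -
  have "ball p = gpow ` {- int p..int p}"
  proof (intro equalityI subsetI)
    fix g
    assume g: "g \<in> ball p"
    then obtain k where "g = gpow k"
      using pow_surj by (auto simp: mem_ball)
    with g show "g \<in> gpow ` {- int p..int p}"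
      by (intro image_eqI[of _ _ k]) (auto simp: mem_ball nf_pow)
  qed (auto simp: mem_ball nf_pow)
  moreover have "tuples n (gpow ` A) = map gpow ` tuples n A" for A
  proof (intro equalityI subsetI)
    fix xs
    assume "xs \<in> tuples n (gpow ` A)"
    then have "length xs = n" "\<forall>x\<in>set xs. \<exists>k. k \<in> A \<and> gpow k = x"
      by (auto simp: tuples_def)
    moreover from this(2) obtain f where "\<forall>x\<in>set xs. f x \<in> A \<and> gpow (f x) = x"
      using bchoice[of "set xs" "\<lambda>x k. k \<in> A \<and> gpow k = x"] by blast
    ultimately show "xs \<in> map gpow ` tuples n A"
      by (intro image_eqI[of _ _ "map f xs"]) (auto simp: tuples_def map_idI)
  qed (auto simp: tuples_def subset_iff)
  ultimately show ?thesis
    by simp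
qed

lemma card_tuples_ball_Int:
  "card (S \<inter> tuples n (ball p)) = card {ks \<in> tuples n {- int p..int p}. map gpow ks \<in> S}"
proof -
  have "S \<inter> tuples n (ball p) = map gpow ` {ks \<in> tuples n {- int p..int p}. map gpow ks \<in> S}"
    unfolding tuples_ball_eq by auto
  then show ?thesis
    using inj_pow by (simp add: card_image inj_on_subset[OF inj_mapI])
qed

lemma card_tuples_ball: "card (tuples n (ball p)) = (2 * p + 1) ^ n"
  using card_tuples_ball_Int[of UNIV n p] by (simp add: card_int_box)

lemma carrier_commute: "g \<in> carrier G \<Longrightarrow> h \<in> carrier G \<Longrightarrow> g \<otimes> h = h \<otimes> g"
  using pow_surj[of g] pow_surj[of h] by (auto simp: add.commute simp flip: int_pow_mult)

lemma density_zero_of_finite: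
  assumes "finite F" "S \<inter> tuples n (carrier G) \<subseteq> F" "0 < n"
  shows "has_asymptotic_density G {y} n S 0"
proof (rule density_zeroI)
  show "S \<inter> tuples n (ball p) \<subseteq> F" for p
    using assms(2) tuples_ball_subset by blast
  have "(\<lambda>p. real (card F) * (1 / real (2 * p + 1)) ^ n) \<longlonglongrightarrow> real (card F) * 0 ^ n"
    by (intro tendsto_intros) real_asymp
  then show "(\<lambda>p. real (card F) / real (card (tuples n (ball p)))) \<longlonglongrightarrow> 0"
    using assms(3) by (simp add: card_tuples_ball power_divide zero_power)
qed (use assms in auto)

text \<open>The exponents occurring in the image form an ideal of the integers generated by
  \<open>ks\<close>, that is, by their gcd. Surjectivity means that this ideal contains 1.\<close>

lemma epi_iff_Gcd:
  assumes G': "free_group G' (set gs)" and \<phi>: "\<phi> \<in> hom G' G" "map \<phi> gs = map gpow ks"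
  shows "\<phi> \<in> epi G' G \<longleftrightarrow> Gcd (set ks) = 1"
proof -
  interpret G': free_group G' "set gs"
    by (rule G')
  interpret hom: group_hom G' G \<phi>
    using \<phi>(1) by unfold_locales
  have im: "\<phi> ` set gs = gpow ` set ks"
    using \<phi>(2) by (metis list.set_map)
  define I where "I = {m. gpow m \<in> \<phi> ` carrier G'}"
  have I_add: "k + l \<in> I" if "k \<in> I" "l \<in> I" for k l
  proof -
    from that obtain g h where "g \<in> carrier G'" "gpow k = \<phi> g" "h \<in> carrier G'" "gpow l = \<phi> h"
      by (auto simp: I_def)
    then have "gpow (k + l) = \<phi> (g \<otimes>\<^bsub>G'\<^esub> h)" "g \<otimes>\<^bsub>G'\<^esub> h \<in> carrier G'"
      by (simp_all flip: int_pow_mult add: hom.hom_mult int_pow_mult)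
    then show ?thesis
      by (auto simp: I_def)
  qed
  have I_mult: "m * k \<in> I" if k: "k \<in> I" for k m
  proof -
    from k obtain g where g: "g \<in> carrier G'" "gpow k = \<phi> g"
      by (auto simp: I_def)
    have "gpow (m * k) = gpow k [^] m"
      by (simp add: int_pow_pow mult.commute)
    also have "\<dots> = \<phi> (g [^]\<^bsub>G'\<^esub> m)"
      using g hom.hom_int_pow by simp
    finally show ?thesis
      using g by (auto simp: I_def)
  qed
  have I_Gcd: "Gcd (set ls) \<in> I" if "set ls \<subseteq> I" for ls
    using that
  proof (induction ls)
    case Nil
    have "gpow 0 = \<phi> \<one>\<^bsub>G'\<^esub>"
      by simp
    then have "0 \<in> I"
      using G'.one_closed unfolding I_def by blast
    then show ?case
      by simp
  next
    case (Cons l ls)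
    \<comment> \<open>Bezout coefficients express the gcd by the two operations under which
      \<open>I\<close> is closed.\<close>
    obtain u v where "u * l + v * Gcd (set ls) = gcd l (Gcd (set ls))"
      using bezout_int by blast
    moreover have "u * l + v * Gcd (set ls) \<in> I"
      using Cons by (intro I_add I_mult) auto
    ultimately show ?case
      by simp
  qed
  have I_dvd: "\<exists>m. \<phi> (eval_word G' w) = gpow (Gcd (set ks) * m)" if "w \<in> words_over (set gs)" for w
    using that
  proof (induction w)
    case Nil
    show ?case
      by (intro exI[of _ 0]) simp
  next
    case (Cons s w)
    then obtain m where m: "\<phi> (eval_word G' w) = gpow (Gcd (set ks) * m)"
      by auto
    from Cons.prems have s: "fst s \<in> set gs"
      by simp
    with im obtain k where k: "k \<in> set ks" "\<phi> (fst s) = gpow k"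
      by (metis imageE imageI)
    from k(1) obtain l where l: "k = Gcd (set ks) * l"
      using Gcd_dvd by blast
    define l' where "l' = (if snd s then l else - l)"
    have "\<phi> (eval_letter G' s) = gpow (Gcd (set ks) * l')"
      using s G'.basis_closed k(2) by (auto simp: eval_letter_def l'_def int_pow_neg simp flip: l)
    moreover have "eval_letter G' s \<in> carrier G'" "eval_word G' w \<in> carrier G'"
      using s Cons.prems G'.basis_closed by auto
    ultimately have "\<phi> (eval_word G' (s # w)) = gpow (Gcd (set ks) * (l' + m))"
      using m by (simp add: int_pow_mult distrib_left)
    then show ?case
      by blast
  qed
  show ?thesis
  proof
    assume "\<phi> \<in> epi G' G"
    then have "gpow 1 \<in> \<phi> ` carrier G'"
      by (simp add: epi_def)
    then obtain g where g: "g \<in> carrier G'" "gpow 1 = \<phi> g"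
      by auto
    with I_dvd[of "G'.nf g"] obtain m where "gpow 1 = gpow (Gcd (set ks) * m)"
      by auto
    then have "1 = Gcd (set ks) * m"
      using inj_pow by (rule injD[rotated])
    then have "Gcd (set ks) dvd 1"
      by (rule dvdI)
    \<comment> \<open>\<open>Gcd\<close> on integers is nonnegative, which excludes the unit
      -1.\<close>
    then show "Gcd (set ks) = 1"
      by (metis abs_Gcd_eq zdvd1_eq)
  next
    assume Gcd: "Gcd (set ks) = 1"
    have "set ks \<subseteq> I"
    proof
      fix k
      assume "k \<in> set ks"
      then have "gpow k \<in> \<phi> ` set gs"
        using im by blast
      then show "k \<in> I"
        using G'.basis_closed by (auto simp: I_def)
    qed
    then have "1 \<in> I"
      using I_Gcd[of ks] Gcd by simp
    then have "m \<in> I" for m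
      using I_mult[of 1 m] by simp
    then have "carrier G \<subseteq> \<phi> ` carrier G'"
      using pow_surj by (fastforce simp: I_def)
    then show "\<phi> \<in> epi G' G"
      using \<phi>(1) by (simp add: epi_iff_subset)
  qed
qed

text \<open>Homomorphisms are functions on the whole type, so several may share a tuple. The gcd
  criterion depends on the tuple alone and gives the same answer for each of them.\<close>

lemma epi_tuples_iff_Gcd:
  assumes G': "free_group G' (set gs)" and gs: "distinct gs" "length gs = n" and ks: "length ks = n"
  shows "map gpow ks \<in> hom_tuples gs (epi G' G) \<longleftrightarrow> Gcd (set ks) = 1"
proof -
  interpret G': free_group G' "set gs"
    by (rule G')
  have "map gpow ks \<in> tuples n (carrier G)"
    using ks by (auto simp: tuples_def)
  then obtain \<phi> where \<phi>: "\<phi> \<in> hom G' G" "map \<phi> gs = map gpow ks"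
    using G'.ex_hom_tuple[OF is_group refl gs] by blast
  show ?thesis
  proof
    assume "map gpow ks \<in> hom_tuples gs (epi G' G)"
    then obtain \<psi> where "\<psi> \<in> epi G' G" "map \<psi> gs = map gpow ks"
      by (auto simp: hom_tuples_def)
    moreover from this have "\<psi> \<in> hom G' G"
      by (simp add: epi_def)
    ultimately show "Gcd (set ks) = 1"
      using epi_iff_Gcd[OF G'] by blast
  next
    assume "Gcd (set ks) = 1"
    then have "\<phi> \<in> epi G' G"
      using epi_iff_Gcd[OF G' \<phi>] by blast
    then show "map gpow ks \<in> hom_tuples gs (epi G' G)"
      unfolding hom_tuples_def \<phi>(2)[symmetric] by (rule imageI)
  qed
qed

lemma epi_density:
  assumes G': "free_group G' (set gs)" and gs: "distinct gs" "length gs = n" and n: "n > 1"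
  shows "has_asymptotic_density G {y} n (hom_tuples gs (epi G' G)) (1 / zeta (real n))"
proof -
  have "card (hom_tuples gs (epi G' G) \<inter> tuples n (ball p)) = card (coprime_tuples n p)" for p
    unfolding card_tuples_ball_Int coprime_tuples_def
    using epi_tuples_iff_Gcd[OF G' gs] by (intro arg_cong[where f = card]) (auto simp: tuples_def)
  then show ?thesis
    using coprime_tuples_density[of n] n by (simp add: has_asymptotic_density_def card_tuples_ball)
qed

text \<open>Two distinct generators do not commute, as the normal forms of their products show,
  whereas their images do.\<close>

lemma mon_empty:
  assumes G': "free_group G' (set gs)" and gs: "distinct gs" "length gs > 1"
  shows "mon G' G = {}"
proof -
  interpret G': free_group G' "set gs"
    by (rule G')
  obtain a b gs' where "gs = a # b # gs'"
    using gs(2) that by (cases gs; cases "tl gs") auto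
  with gs(1) have ab: "a \<in> set gs" "b \<in> set gs" "a \<noteq> b"
    by auto
  then have cl: "a \<in> carrier G'" "b \<in> carrier G'"
    using G'.basis_closed by auto
  have nf: "G'.nf (c \<otimes>\<^bsub>G'\<^esub> d) = [(c, True), (d, True)]" if "c \<in> set gs" "d \<in> set gs" for c d
    using that G'.basis_closed
    by (intro G'.nf_eqI) (auto simp: reduced_Cons inv_letter_def eval_letter_def)
  have "False" if "\<phi> \<in> mon G' G" for \<phi>
  proof -
    have \<phi>: "\<phi> \<in> hom G' G" "inj_on \<phi> (carrier G')"
      using that by (simp_all add: mon_def)
    then have "\<phi> (a \<otimes>\<^bsub>G'\<^esub> b) = \<phi> (b \<otimes>\<^bsub>G'\<^esub> a)"
      using cl by (simp add: hom_mult[OF \<phi>(1)] carrier_commute hom_in_carrier[OF \<phi>(1)])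
    then have "a \<otimes>\<^bsub>G'\<^esub> b = b \<otimes>\<^bsub>G'\<^esub> a"
      using \<phi>(2) cl by (simp add: inj_on_eq_iff)
    then show False
      using nf[OF ab(1,2)] nf[OF ab(2,1)] ab(3) by simp
  qed
  then show ?thesis
    by blast
qed

lemma rank_one_density:
  assumes G': "free_group G' {a}"
  shows "has_asymptotic_density G {y} 1 (hom_tuples [a] (epi G' G)) 0"
    and "has_asymptotic_density G {y} 1 (hom_tuples [a] (mon G' G)) 1"
proof -
  interpret G': rank_one_free_group G' a
    using G' by (simp add: rank_one_free_group_def)
  have G'': "free_group G' (set [a])"
    using G' by simp
  have tuple: "\<exists>k. xs = map gpow [k]" if "xs \<in> tuples 1 (carrier G)" for xs
    using that pow_surj by (auto simp: tuples_def length_Suc_conv)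
  show "has_asymptotic_density G {y} 1 (hom_tuples [a] (epi G' G)) 0"
  \<comment> \<open>Only the exponents 1 and -1 generate the integers.\<close>
  proof (rule density_zero_of_finite[where F = "{[gpow 1], [gpow (- 1)]}"])
    show "hom_tuples [a] (epi G' G) \<inter> tuples 1 (carrier G) \<subseteq> {[gpow 1], [gpow (- 1)]}"
    proof
      fix xs
      assume xs: "xs \<in> hom_tuples [a] (epi G' G) \<inter> tuples 1 (carrier G)"
      then obtain k where k: "xs = map gpow [k]"
        using tuple by blast
      then have "Gcd (set [k]) = 1"
        using epi_tuples_iff_Gcd[OF G'', of 1 "[k]"] xs by auto
      then have "k = 1 \<or> k = - 1"
        by auto
      then show "xs \<in> {[gpow 1], [gpow (- 1)]}"
        using k by auto
    qed
  qed simp_all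
  show "has_asymptotic_density G {y} 1 (hom_tuples [a] (mon G' G)) 1"
  \<comment> \<open>Only the trivial homomorphism fails to be injective: if \<open>a\<close> is sent
    to \<open>gpow k\<close> with \<open>k \<noteq> 0\<close>, a kernel element with exponent
    \<open>m\<close> satisfies \<open>k * m = 0\<close>.\<close>
  proof (rule density_one_of_complement, simp, rule density_zero_of_finite[where F = "{[\<one>]}"])
    show "(tuples 1 (carrier G) - hom_tuples [a] (mon G' G)) \<inter> tuples 1 (carrier G) \<subseteq> {[\<one>]}"
    proof (rule subsetI, rule ccontr)
      fix xs
      assume xs: "xs \<in> (tuples 1 (carrier G) - hom_tuples [a] (mon G' G)) \<inter> tuples 1 (carrier G)"
        and ne: "xs \<notin> {[\<one>]}"
      then obtain k where k: "xs = map gpow [k]"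
        using tuple by blast
      with ne have "k \<noteq> 0"
        by auto
      obtain \<phi> where \<phi>: "\<phi> \<in> hom G' G" "map \<phi> [a] = xs"
        using G'.ex_hom_tuple[OF is_group, of "[a]" 1 xs] xs by auto
      interpret hom: group_hom G' G \<phi>
        using \<phi>(1) by unfold_locales
      have "g = \<one>\<^bsub>G'\<^esub>" if g: "g \<in> carrier G'" "\<phi> g = \<one>" for g
      proof -
        obtain m where m: "g = a [^]\<^bsub>G'\<^esub> (m :: int)"
          using G'.pow_surj[OF g(1)] by blast
        have "gpow (k * m) = \<phi> a [^] m"
          using \<phi>(2) k by (simp add: int_pow_pow)
        also have "\<dots> = \<phi> g"
          using hom.hom_int_pow[of a m] m by simp
        also have "\<dots> = gpow 0"
          using g(2) by simp
        finally have "k * m = 0"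
          using inj_pow by (rule injD[rotated])
        then show ?thesis
          using \<open>k \<noteq> 0\<close> m by simp
      qed
      then have "\<phi> \<in> mon G' G"
        using \<phi>(1) by (simp add: mon_def hom.inj_on_one_iff)
      with \<phi>(2) xs show False
        by (auto simp: hom_tuples_def)
    qed
  qed simp_all
qed

end

theorem theorem7:
  fixes G :: "('a, 'c) monoid_scheme" and H :: "('b, 'd) monoid_scheme"
    and gs :: "'a list" and Y :: "'b set" and n :: nat
  assumes G_free: "free_group_on G (set gs)" and gs: "distinct gs" "length gs = n"
    and H_free: "free_group_on H Y" and Y: "finite Y"
  shows "(card Y = 1 \<and> n > 1 \<longrightarrow>
            has_asymptotic_density H Y n (hom_tuples gs (epi G H)) (1 / zeta (real n)) \<and>
            has_asymptotic_density H Y n (hom_tuples gs (mon G H)) 0) \<and>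
         ((n = 1 \<and> card Y = 1) \<or> card Y > 1 \<longrightarrow>
            has_asymptotic_density H Y n (hom_tuples gs (epi G H)) 0 \<and>
            has_asymptotic_density H Y n (hom_tuples gs (mon G H)) 1)"
proof -
  have G: "free_group G (set gs)" and H: "free_group H Y"
    using G_free H_free by (simp_all add: free_group_on_iff)
  interpret H: free_group H Y
    by (rule H)
  have one: "rank_one_free_group H y" if "Y = {y}" for y
    using H that by (simp add: rank_one_free_group_def)
  show ?thesis
  proof (intro conjI impI; (elim conjE)?)
    assume "card Y = 1" and n: "n > 1"
    then obtain y where y: "Y = {y}"
      by (auto simp: card_1_singleton_iff)
    interpret H1: rank_one_free_group H y
      by (rule one[OF y])
    show "has_asymptotic_density H Y n (hom_tuples gs (epi G H)) (1 / zeta (real n))"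
      unfolding y by (rule H1.epi_density[OF G gs n])
    have "mon G H = {}"
      using H1.mon_empty[OF G gs(1)] gs(2) n by simp
    then show "has_asymptotic_density H Y n (hom_tuples gs (mon G H)) 0"
      by (simp add: has_asymptotic_density_def hom_tuples_def)
  next
    assume rank: "n = 1 \<and> card Y = 1 \<or> card Y > 1"
    have "has_asymptotic_density H Y n (hom_tuples gs (epi G H)) 0 \<and>
      has_asymptotic_density H Y n (hom_tuples gs (mon G H)) 1"
      using rank
    proof
      assume "n = 1 \<and> card Y = 1"
      then obtain y a where y: "Y = {y}" and a: "gs = [a]" and n: "n = 1"
        using gs by (auto simp: card_1_singleton_iff length_Suc_conv)
      interpret H1: rank_one_free_group H y
        by (rule one[OF y])
      show ?thesis
        using H1.rank_one_density[of G a] G unfolding y a n by simp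
    next
      \<comment> \<open>Here \<open>n = 0\<close> is allowed: the trivial group has one homomorphism
        into \<open>H\<close>, injective and not surjective.\<close>
      assume "card Y > 1"
      then show ?thesis
        using H.higher_rank_density[OF G gs Y] by simp
    qed
    then show "has_asymptotic_density H Y n (hom_tuples gs (epi G H)) 0"
      "has_asymptotic_density H Y n (hom_tuples gs (mon G H)) 1"
      by simp_all
  qed
qed

end
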